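(* Let $\mathcal{U}$ be the $\alpha$-hypercircle associated to the unit $u(t)=\frac{at+b}{t+d}\in\mathbb{K}(\alpha)(t)$, let $r=[\mathbb{K}(-d):\mathbb{K}]$, and let $M(t)\in\mathbb{K}[t]$ be the minimal polynomial of $-d$ over $\mathbb{K}$. Then: 1. There exists an affine transformation $\chi:\mathbb{F}^n\to\mathbb{F}^n$ defined over $\mathbb{K}$ such that the curve $\chi(\mathcal{U})$ is parametrized by $$\widetilde{\chi}(t)=\left(\frac{1}{M(t)},\frac{t}{M(t)},\ldots,\frac{t^{r-1}}{M(t)},0,\ldots,0\right).$$ 2. There exists a projective transformation $\rho:\mathbb{P}(\mathbb{F})^n\to\mathbb{P}(\mathbb{F})^n$ defined over $\mathbb{K}$ such that the curve $\rho(\mathcal{U})$ is the rational normal curve of degree $r$ in $\mathbb{P}(\mathbb{F})^n$, parametrized by $$\widetilde{\rho}(t:s)=[s^r:s^{r-1}t:\cdots:st^{r-1}:t^r:0:\cdots:0].$$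
   Context: $\mathbb{K}$ is a field of characteristic zero, $\mathbb{L}=\mathbb{K}(\alpha)$ is a finite algebraic extension of $\mathbb{K}$ of degree $n$ with primitive element $\alpha$, and $\mathbb{F}$ is the algebraic closure of $\mathbb{K}$. A unit of $\mathbb{L}(t)$ (under composition) is a rational function $u(t)=\frac{at+b}{ct+d}$ with $a,b,c,d\in\mathbb{L}$, $ad-bc\neq 0$. Every unit $u(t)\in\mathbb{L}(t)$ is written uniquely as $u(t)=\sum_{i=0}^{n-1}\phi_i(t)\alpha^i$ with $\phi_i(t)\in\mathbb{K}(t)$, and the $\alpha$-hypercircle generated by (or associated to) $u(t)$ is the rational curve $\mathcal{U}\subseteq\mathbb{F}^n$ parametrized by $(\phi_0(t),\ldots,\phi_{n-1}(t))$ (Zariski closure of the image). Affine and projective transformations are understood to be invertible. In item 2, $\rho(\mathcal{U})$ refers to the image of the projective closure of $\mathcal{U}$ in $\mathbb{P}(\mathbb{F})^n$. *)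

theory Defs
  imports
    "HOL-Algebra.Algebraic_Closure_Type"
    "HOL-Algebra.Generated_Fields"
    "Jordan_Normal_Form.Matrix"
begin

text \<open>The base field \<open>\<bbbK>\<close> is the type \<open>'k\<close>, its algebraic closure \<open>\<bbbF>\<close> is the type
  \<open>'k alg_closure\<close>, and \<open>\<bbbK>\<close> is identified with \<open>range to_ac\<close>. All algebraic extensions
  of \<open>\<bbbK>\<close> are taken inside \<open>\<bbbF>\<close>.\<close>

section \<open>Extension fields\<close>

definition adjoin :: "'k::field alg_closure \<Rightarrow> 'k alg_closure set" where
  "adjoin x = generate_field ring_of_type_algebra (insert x (range to_ac))"

lemma vector_space_alg_closure:
  "vector_space (\<lambda>(c::'k::field) (x::'k alg_closure). to_ac c * x)"
  by standard (simp_all add: algebra_simps)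

definition ext_degree :: "'k::field alg_closure set \<Rightarrow> nat" where
  "ext_degree E = vector_space.dim (\<lambda>(c::'k) x. to_ac c * x) E"

definition is_min_poly :: "'k::field poly \<Rightarrow> 'k alg_closure \<Rightarrow> bool" where
  "is_min_poly M x \<longleftrightarrow> Polynomial.lead_coeff M = 1 \<and> poly (map_poly to_ac M) x = 0 \<and>
     (\<forall>q. q \<noteq> 0 \<and> poly (map_poly to_ac q) x = 0 \<longrightarrow> Polynomial.degree M \<le> Polynomial.degree q)"


section \<open>Rational functions\<close>

text \<open>The subfield \<open>\<bbbK>(t)\<close> of \<open>\<bbbF>(t)\<close>.\<close>

definition ratfuns_over_base :: "'k::field alg_closure poly fract set" where
  "ratfuns_over_base = {Fract (map_poly to_ac p) (map_poly to_ac q) | p q. q \<noteq> 0}"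

text \<open>\<^const>\<open>quot_of_fract\<close> yields numerator and denominator in lowest terms, so
  \<open>ratfun_defined f t\<close> says that \<open>f\<close> has no pole at \<open>t\<close>.\<close>

definition ratfun_defined :: "'k::field alg_closure poly fract \<Rightarrow> 'k alg_closure \<Rightarrow> bool" where
  "ratfun_defined f t \<longleftrightarrow> poly (snd (quot_of_fract f)) t \<noteq> 0"

definition ratfun_eval :: "'k::field alg_closure poly fract \<Rightarrow> 'k alg_closure \<Rightarrow> 'k alg_closure" where
  "ratfun_eval f t = poly (fst (quot_of_fract f)) t / poly (snd (quot_of_fract f)) t"


section \<open>Affine varieties\<close>

text \<open>\<open>poly_fun n f\<close>: \<open>f\<close> is (the function of) a polynomial in the \<open>n\<close> coordinates.\<close>

inductive poly_fun :: "nat \<Rightarrow> ('a::comm_ring_1 vec \<Rightarrow> 'a) \<Rightarrow> bool" for n where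
  const: "poly_fun n (\<lambda>v. c)"
| coord: "i < n \<Longrightarrow> poly_fun n (\<lambda>v. v $ i)"
| add: "poly_fun n f \<Longrightarrow> poly_fun n g \<Longrightarrow> poly_fun n (\<lambda>v. f v + g v)"
| mult: "poly_fun n f \<Longrightarrow> poly_fun n g \<Longrightarrow> poly_fun n (\<lambda>v. f v * g v)"

definition zariski_closed :: "nat \<Rightarrow> 'a::field vec set \<Rightarrow> bool" where
  "zariski_closed n Z \<longleftrightarrow>
     (\<exists>S. (\<forall>f\<in>S. poly_fun n f) \<and> Z = {x \<in> carrier_vec n. \<forall>f\<in>S. f x = 0})"

definition zariski_closure :: "nat \<Rightarrow> 'a::field vec set \<Rightarrow> 'a vec set" where
  "zariski_closure n Y = zariski_closed n hull Y"

text \<open>The curve parametrized by rational functions \<open>f 0, \<dots>, f (n - 1)\<close>.\<close>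

definition rational_curve ::
    "nat \<Rightarrow> (nat \<Rightarrow> 'k::field alg_closure poly fract) \<Rightarrow> 'k alg_closure vec set" where
  "rational_curve n f =
     zariski_closure n {vec n (\<lambda>i. ratfun_eval (f i) t) | t. \<forall>i<n. ratfun_defined (f i) t}"

definition affine_transformation_over_base ::
    "nat \<Rightarrow> ('k::field alg_closure vec \<Rightarrow> 'k alg_closure vec) \<Rightarrow> bool" where
  "affine_transformation_over_base n \<chi> \<longleftrightarrow>
     (\<exists>(A :: 'k mat) (b :: 'k vec). A \<in> carrier_mat n n \<and> invertible_mat A \<and> b \<in> carrier_vec n \<and>
        (\<forall>x \<in> carrier_vec n. \<chi> x = map_mat to_ac A *\<^sub>v x + map_vec to_ac b))"


section \<open>Projective varieties\<close>

text \<open>A point of \<open>n\<close>-dimensional projective space is the set of all its vectors of homogeneous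
  coordinates, which have length \<open>n + 1\<close>.\<close>

definition proj_point :: "'a::field vec \<Rightarrow> 'a vec set" where
  "proj_point v = {c \<cdot>\<^sub>v v | c. c \<noteq> 0}"

definition proj_space :: "nat \<Rightarrow> 'a::field vec set set" where
  "proj_space n = {proj_point v | v. v \<in> carrier_vec (Suc n) \<and> v \<noteq> 0\<^sub>v (Suc n)}"

text \<open>\<open>hom_poly_fun m d f\<close>: \<open>f\<close> is a homogeneous polynomial of degree \<open>d\<close> (or zero) in \<open>m\<close>
  coordinates.\<close>

inductive hom_poly_fun :: "nat \<Rightarrow> nat \<Rightarrow> ('a::comm_ring_1 vec \<Rightarrow> 'a) \<Rightarrow> bool" for m where
  const: "hom_poly_fun m 0 (\<lambda>v. c)"
| coord: "i < m \<Longrightarrow> hom_poly_fun m 1 (\<lambda>v. v $ i)"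
| add: "hom_poly_fun m d f \<Longrightarrow> hom_poly_fun m d g \<Longrightarrow> hom_poly_fun m d (\<lambda>v. f v + g v)"
| mult: "hom_poly_fun m d f \<Longrightarrow> hom_poly_fun m e g \<Longrightarrow> hom_poly_fun m (d + e) (\<lambda>v. f v * g v)"

definition proj_zariski_closed :: "nat \<Rightarrow> 'a::field vec set set \<Rightarrow> bool" where
  "proj_zariski_closed n Z \<longleftrightarrow>
     (\<exists>S. (\<forall>f\<in>S. \<exists>d. hom_poly_fun (Suc n) d f) \<and>
          Z = {P \<in> proj_space n. \<forall>f\<in>S. \<forall>v\<in>P. f v = 0})"

text \<open>Affine space is embedded by \<open>(x\<^sub>1, \<dots>, x\<^sub>n) \<mapsto> [1 : x\<^sub>1 : \<dots> : x\<^sub>n]\<close>.\<close>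

definition proj_closure :: "nat \<Rightarrow> 'a::field vec set \<Rightarrow> 'a vec set set" where
  "proj_closure n Y = proj_zariski_closed n hull ((\<lambda>x. proj_point (vCons 1 x)) ` Y)"

definition proj_transformation_over_base ::
    "nat \<Rightarrow> ('k::field alg_closure vec set \<Rightarrow> 'k alg_closure vec set) \<Rightarrow> bool" where
  "proj_transformation_over_base n \<rho> \<longleftrightarrow>
     (\<exists>A :: 'k mat. A \<in> carrier_mat (Suc n) (Suc n) \<and> invertible_mat A \<and>
        (\<forall>v \<in> carrier_vec (Suc n). v \<noteq> 0\<^sub>v (Suc n) \<longrightarrow>
           \<rho> (proj_point v) = proj_point (map_mat to_ac A *\<^sub>v v)))"

text \<open>The rational normal curve of degree \<open>r\<close> in \<open>n\<close>-space, given by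
  \<open>(t : s) \<mapsto> [s\<^sup>r : s\<^sup>r\<^sup>-\<^sup>1 t : \<dots> : t\<^sup>r : 0 : \<dots> : 0]\<close>, for \<open>r \<le> n\<close>.\<close>

definition rational_normal_curve :: "nat \<Rightarrow> nat \<Rightarrow> 'a::field vec set set" where
  "rational_normal_curve n r =
     {proj_point (vec (Suc n) (\<lambda>i. if i \<le> r then s ^ (r - i) * t ^ i else 0)) | t s.
        (t, s) \<noteq> (0, 0)}"


section \<open>Hypercircles\<close>

text \<open>The unique \<open>\<phi>\<^sub>0, \<dots>, \<phi>\<^sub>n\<^sub>-\<^sub>1 \<in> \<bbbK>(t)\<close> with \<open>u = \<Sum>\<^sub>i \<phi>\<^sub>i \<alpha>\<^sup>i\<close>, where \<open>n = [\<bbbK>(\<alpha>) : \<bbbK>]\<close>,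
  extended by zero to all indices.\<close>

definition alpha_components ::
    "'k::field alg_closure \<Rightarrow> 'k alg_closure poly fract \<Rightarrow> nat \<Rightarrow> 'k alg_closure poly fract" where
  "alpha_components \<alpha> u = (THE \<phi>.
     (\<forall>i < ext_degree (adjoin \<alpha>). \<phi> i \<in> ratfuns_over_base) \<and>
     (\<forall>i \<ge> ext_degree (adjoin \<alpha>). \<phi> i = 0) \<and>
     u = (\<Sum>i < ext_degree (adjoin \<alpha>). \<phi> i * to_fract [:\<alpha>:] ^ i))"

definition hypercircle ::
    "'k::field alg_closure \<Rightarrow> 'k alg_closure poly fract \<Rightarrow> 'k alg_closure vec set" where
  "hypercircle \<alpha> u = rational_curve (ext_degree (adjoin \<alpha>)) (alpha_components \<alpha> u)"

end

theory Submission
  imports Defs "Jordan_Normal_Form.Char_Poly"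
begin

text \<open>Write \<open>u = a + (b - a d) / (t + d)\<close> and \<open>M = (t + d) \<Sum>\<^sub>i m\<^sub>i t\<^sup>i\<close> with \<open>m\<^sub>i \<in> \<bbbK>(d)\<close>, so that
  \<open>u = a + \<Sum>\<^sub>i (b - a d) m\<^sub>i \<cdot> t\<^sup>i / M\<close>. The \<open>r\<close> elements \<open>(b - a d) m\<^sub>i\<close> are linearly independent over \<open>\<bbbK>\<close>
  and extend to a basis of \<open>\<bbbK>(\<alpha>)\<close>; the change of basis to the powers of \<open>\<alpha>\<close> turns
  \<open>(1/M, t/M, \<dots>, t\<^sup>r\<^sup>-\<^sup>1/M, 0, \<dots>)\<close> into the components of \<open>u - a\<close>. Projectively this curve is
  \<open>(M : 1 : t : \<dots> : t\<^sup>r\<^sup>-\<^sup>1 : 0 : \<dots>)\<close>, and as \<open>M\<close> is monic of degree \<open>r\<close>, a linear change of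
  coordinates gives \<open>(1 : t : \<dots> : t\<^sup>r : 0 : \<dots>)\<close>, with finitely many parameters \<open>t\<close> missing. The
  rational normal curve is the closure of these points: it is closed, being cut out by the
  \<open>2 \<times> 2\<close> minors, and a form vanishing at almost all parameters vanishes identically on it.\<close>

text \<open>A curve is the closure of a set of points, so an identity between rational functions is
  useful only once it is an identity between point sets, with poles accounted for. The coordinates
  before and after the affine change are combinations of each other with constant coefficients,
  hence have a common domain; on the side of (1/M, t/M, ...) it is the complement of the roots of M,
  since 1/M admits no cancellation. Thus the lost parameters are these roots and the point s = 0.
  Passing to the denominator M serves to define everything over K: M lies in K[t], so elements
  outside K remain only as constant factors, and taking coordinates with respect to the powers of
  \<alpha> is a matter of constants. All matrices are formed over K and embedded in F afterwards.
  Closures are moved by one principle: a bijection that, like its inverse, pulls closed sets back to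
  closed sets commutes with hulls.\<close>

no_notation fps_nth (infixl \<open>$\<close> 75)

section \<open>Simple algebraic extensions\<close>

interpretation to_ac_hom: field_hom "to_ac :: 'k::field \<Rightarrow> _"
  by standard auto

interpretation to_ac_poly_hom: map_poly_inj_idom_hom "to_ac :: 'k::field \<Rightarrow> _" ..

declare to_ac_hom.map_poly_pCons_hom [simp]

abbreviation aeval :: "'k::field poly \<Rightarrow> 'k alg_closure \<Rightarrow> 'k alg_closure" where
  "aeval p x \<equiv> poly (map_poly to_ac p) x"

section \<open>The field K(x) as the set of polynomial expressions in x\<close>

lemma ring_of_type_algebra_sel [simp]:
  "carrier ring_of_type_algebra = (UNIV :: 'a::field set)"
  "\<one>\<^bsub>ring_of_type_algebra\<^esub> = (1::'a)"
  "\<zero>\<^bsub>ring_of_type_algebra\<^esub> = (0::'a)"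
  "x \<oplus>\<^bsub>ring_of_type_algebra\<^esub> y = x + (y::'a)"
  "x \<otimes>\<^bsub>ring_of_type_algebra\<^esub> y = x * (y::'a)"
  by (simp_all add: ring_of_type_algebra_def)

lemma ring_of_type_algebra_a_inv [simp]: "\<ominus>\<^bsub>ring_of_type_algebra\<^esub> x = - (x::'a::field)"
proof -
  interpret R: field "ring_of_type_algebra :: 'a ring"
    by (rule field_from_type_algebra)
  show ?thesis
    using R.minus_equality[of "- x" x] by simp
qed

lemma ring_of_type_algebra_m_inv [simp]:
  assumes "x \<noteq> 0"
  shows "inv\<^bsub>ring_of_type_algebra\<^esub> x = inverse (x::'a::field)"
proof -
  interpret R: field "ring_of_type_algebra :: 'a ring"
    by (rule field_from_type_algebra)
  show ?thesis
    using R.inv_unique'[of x "inverse x"] assms by simp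
qed

lemma adjoin_base [simp]: "to_ac c \<in> adjoin x"
  unfolding adjoin_def by (rule generate_field.incl) simp

lemma adjoin_gen [simp]: "x \<in> adjoin x"
  unfolding adjoin_def by (rule generate_field.incl) simp

lemma adjoin_add: "y \<in> adjoin x \<Longrightarrow> z \<in> adjoin x \<Longrightarrow> y + z \<in> adjoin x"
  unfolding adjoin_def by (metis generate_field.eng_add ring_of_type_algebra_sel(4))

lemma adjoin_mult: "y \<in> adjoin x \<Longrightarrow> z \<in> adjoin x \<Longrightarrow> y * z \<in> adjoin x"
  unfolding adjoin_def by (metis generate_field.eng_mult ring_of_type_algebra_sel(5))

lemma adjoin_uminus: "y \<in> adjoin x \<Longrightarrow> - y \<in> adjoin x"
  unfolding adjoin_def by (metis generate_field.a_inv ring_of_type_algebra_a_inv)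

lemma adjoin_diff: "y \<in> adjoin x \<Longrightarrow> z \<in> adjoin x \<Longrightarrow> y - z \<in> adjoin x"
  using adjoin_add[OF _ adjoin_uminus] by fastforce

lemma aeval_in_adjoin: "y \<in> adjoin x \<Longrightarrow> aeval p y \<in> adjoin x"
proof (induction p)
  case 0
  show ?case using adjoin_base[of 0 x] by simp
next
  case (pCons c p)
  then show ?case by (simp add: adjoin_add adjoin_mult)
qed

lemma is_min_poly_exists: "\<exists>M. is_min_poly M x"
proof -
  define P where "P q \<longleftrightarrow> q \<noteq> 0 \<and> aeval q x = 0" for q :: "'a poly"
  obtain q0 :: "'a poly" where q0: "P q0"
    unfolding P_def using alg_closure_algebraic[of x] by blast
  define q where "q = arg_min Polynomial.degree P"
  have q: "P q" and q_min: "P p \<Longrightarrow> Polynomial.degree q \<le> Polynomial.degree p" for p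
    unfolding q_def using arg_min_nat_lemma[of P q0, OF q0] by auto
  define M where "M = Polynomial.smult (inverse (Polynomial.lead_coeff q)) q"
  have "is_min_poly M x"
    unfolding is_min_poly_def M_def using q q_min unfolding P_def
    by (auto simp: to_ac_hom.map_poly_hom_smult)
  then show ?thesis ..
qed

lemma is_min_poly_nonzero: "is_min_poly M x \<Longrightarrow> M \<noteq> 0"
  by (auto simp: is_min_poly_def)

lemma aeval_eq_0_small_degree:
  assumes "is_min_poly M x" "Polynomial.degree p < Polynomial.degree M" "aeval p x = 0"
  shows "p = 0"
  using assms unfolding is_min_poly_def by (meson not_le)

lemma is_min_poly_degree_pos:
  assumes "is_min_poly M x" shows "Polynomial.degree M > 0"
proof (rule ccontr)
  assume "\<not> Polynomial.degree M > 0"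
  then obtain c where c: "M = [:c:]" by (metis degree_eq_zeroE gr0I)
  with assms show False by (auto simp: is_min_poly_def)
qed

text \<open>If the constant term \<open>c\<close> of the minimal polynomial of \<open>y\<close>
  vanished, dividing by y would leave an annihilating polynomial of smaller degree. So
  \<open>c\<close> is nonzero, and y R(y) = - c exhibits the inverse.\<close>

lemma aeval_inverse:
  assumes "y \<noteq> 0"
  shows "\<exists>p. inverse y = aeval p y"
proof -
  obtain Q where Q: "is_min_poly Q y" using is_min_poly_exists by blast
  obtain c R where QR: "Q = pCons c R" by (cases Q)
  have eq: "to_ac c + y * aeval R y = 0" using Q by (simp add: QR is_min_poly_def)
  have "c \<noteq> 0"
  proof
    assume "c = 0"
    with eq assms have "aeval R y = 0" by simp
    moreover have "R \<noteq> 0" using \<open>c = 0\<close> QR is_min_poly_nonzero[OF Q] by auto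
    moreover from this have "Polynomial.degree R < Polynomial.degree Q" by (simp add: QR)
    ultimately show False using aeval_eq_0_small_degree[OF Q] by blast
  qed
  have "y * aeval R y = - to_ac c"
    using eq by (simp add: eq_neg_iff_add_eq_0 add.commute)
  then have "y * aeval (Polynomial.smult (- inverse c) R) y = 1"
    unfolding to_ac_hom.map_poly_hom_smult poly_smult mult.left_commute[of y]
    using \<open>c \<noteq> 0\<close> by simp
  then have "inverse y = aeval (Polynomial.smult (- inverse c) R) y"
    by (rule inverse_unique)
  then show ?thesis ..
qed

text \<open>No fractions arise: the inverse of h is a polynomial in h, and composing it with h =
  p(x) gives a polynomial in x.\<close>

lemma adjoin_eq_range_aeval: "adjoin x = range (\<lambda>p. aeval p x)"
proof (intro equalityI subsetI)
  fix y assume "y \<in> adjoin x"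
  then have "\<exists>p. y = aeval p x" unfolding adjoin_def
  proof (induction rule: generate_field.induct)
    case one
    show ?case by (rule exI[of _ 1]) simp
  next
    case (incl h)
    then consider "h = x" | c where "h = to_ac c" by auto
    then show ?case
    proof cases
      case 1 then show ?thesis by (intro exI[of _ "[:0, 1:]"]) simp
    next
      case 2 then show ?thesis by (intro exI[of _ "[:c:]"]) simp
    qed
  next
    case (a_inv h)
    then show ?case by (metis ring_of_type_algebra_a_inv poly_minus to_ac_poly_hom.hom_uminus)
  next
    case (m_inv h)
    then obtain p q where "h = aeval p x" "inverse h = aeval q h"
      using aeval_inverse[of h] by auto
    then have "inverse h = aeval (q \<circ>\<^sub>p p) x"
      by (simp add: to_ac_hom.map_poly_pcompose poly_pcompose)
    then show ?case using m_inv by auto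
  next
    case (eng_add h1 h2)
    then show ?case by (metis ring_of_type_algebra_sel(4) poly_add to_ac_poly_hom.hom_add)
  next
    case (eng_mult h1 h2)
    then show ?case by (metis ring_of_type_algebra_sel(5) poly_mult to_ac_poly_hom.hom_mult)
  qed
  then show "y \<in> range (\<lambda>p. aeval p x)" by auto
qed (auto intro: aeval_in_adjoin)

lemma aeval_small_degree:
  assumes "Polynomial.degree p < n"
  shows "aeval p x = (\<Sum>i<n. to_ac (poly.coeff p i) * x ^ i)"
proof -
  have "aeval p x = (\<Sum>i\<le>Polynomial.degree p. to_ac (poly.coeff p i) * x ^ i)"
    by (simp add: poly_altdef)
  also have "\<dots> = (\<Sum>i<n. to_ac (poly.coeff p i) * x ^ i)"
    by (rule sum.mono_neutral_left) (use assms in \<open>auto simp: coeff_eq_0\<close>)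
  finally show ?thesis .
qed

lemma adjoin_power_basis:
  assumes M: "is_min_poly M x" and y: "y \<in> adjoin x"
  obtains c where "y = (\<Sum>i<Polynomial.degree M. to_ac (c i) * x ^ i)"
proof -
  obtain p where p: "y = aeval p x" using y by (auto simp: adjoin_eq_range_aeval)
  have deg: "Polynomial.degree (p mod M) < Polynomial.degree M"
    using degree_mod_less'[of M p] is_min_poly_nonzero[OF M] is_min_poly_degree_pos[OF M]
    by (cases "p mod M = 0") auto
  have "aeval p x = aeval (p div M * M + p mod M) x" by simp
  also have "\<dots> = aeval (p mod M) x"
    using M unfolding to_ac_poly_hom.hom_add to_ac_poly_hom.hom_mult by (simp add: is_min_poly_def)
  finally have "y = aeval (p mod M) x" by (simp add: p)
  then show ?thesis using that aeval_small_degree[OF deg] by metis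
qed

section \<open>Linear independence over K, and the degree of K(x)\<close>

definition lin_indep :: "nat \<Rightarrow> (nat \<Rightarrow> 'k::field alg_closure) \<Rightarrow> bool" where
  "lin_indep n w \<longleftrightarrow> (\<forall>c. (\<Sum>i<n. to_ac (c i) * w i) = 0 \<longrightarrow> (\<forall>i<n. c i = 0))"

text \<open>A vanishing combination is a polynomial of degree below that of \<open>M\<close> with
  root \<open>x\<close>, hence zero by minimality.\<close>

lemma lin_indep_powers:
  assumes M: "is_min_poly M x"
  shows "lin_indep (Polynomial.degree M) (\<lambda>i. x ^ i)"
  unfolding lin_indep_def
proof (intro allI impI)
  fix c :: "nat \<Rightarrow> 'a" and i
  assume sum: "(\<Sum>i<Polynomial.degree M. to_ac (c i) * x ^ i) = 0" and i: "i < Polynomial.degree M"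
  define p where "p = (\<Sum>i<Polynomial.degree M. Polynomial.monom (c i) i)"
  have coeff: "poly.coeff p j = (if j < Polynomial.degree M then c j else 0)" for j
    by (auto simp: p_def Polynomial.coeff_sum if_distrib[of "\<lambda>c. c = _"] sum.delta' cong: if_cong)
  have deg: "Polynomial.degree p < Polynomial.degree M"
    using is_min_poly_degree_pos[OF M] by (intro Polynomial.degree_lessI) (auto simp: coeff)
  have "aeval p x = 0"
    using sum by (simp add: aeval_small_degree[OF deg] coeff cong: sum.cong_simp)
  then have "p = 0" using aeval_eq_0_small_degree[OF M deg] by blast
  then show "c i = 0" using coeff[of i] i by simp
qed

interpretation ac_vs: vector_space "\<lambda>(c::'k::field) (x::'k alg_closure). to_ac c * x"
  by (rule vector_space_alg_closure)

lemma lin_indepD_inj: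
  assumes "lin_indep n w"
  shows "inj_on w {..<n}"
proof (rule inj_onI, rule ccontr)
  fix i j assume ij: "i \<in> {..<n}" "j \<in> {..<n}" "w i = w j" "i \<noteq> j"
  define c where "c k = (if k = i then 1 else if k = j then - 1 else (0::'a))" for k
  have "(\<Sum>k<n. to_ac (c k) * w k) = (\<Sum>k\<in>{i,j}. to_ac (c k) * w k)"
    by (rule sum.mono_neutral_right) (use ij in \<open>auto simp: c_def\<close>)
  also have "\<dots> = 0" using ij by (simp add: c_def)
  finally have "c i = 0" using assms ij by (auto simp: lin_indep_def)
  then show False by (simp add: c_def)
qed

text \<open>Families serve as matrix columns, whereas bases of \<open>ac_vs\<close> are sets. A
  family with a repetition is dependent although its range may be independent, hence the
  injectivity.\<close>

lemma lin_indep_iff: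
  "lin_indep n w \<longleftrightarrow> inj_on w {..<n} \<and> \<not> ac_vs.dependent (w ` {..<n})"
proof
  assume w: "lin_indep n w"
  note inj = lin_indepD_inj[OF w]
  have "\<not> ac_vs.dependent (w ` {..<n})"
  proof (rule ac_vs.independent_if_scalars_zero)
    fix f x assume sum: "(\<Sum>x\<in>w ` {..<n}. to_ac (f x) * x) = 0" and x: "x \<in> w ` {..<n}"
    have "(\<Sum>i<n. to_ac (f (w i)) * w i) = 0"
      using sum by (simp add: sum.reindex[OF inj])
    then have "\<forall>i<n. f (w i) = 0"
      using w unfolding lin_indep_def by (elim allE[of _ "\<lambda>i. f (w i)"]) simp
    then show "f x = 0" using x by auto
  qed simp
  with inj show "inj_on w {..<n} \<and> \<not> ac_vs.dependent (w ` {..<n})" by blast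
next
  assume *: "inj_on w {..<n} \<and> \<not> ac_vs.dependent (w ` {..<n})"
  show "lin_indep n w"
    unfolding lin_indep_def
  proof (intro allI impI)
    fix c :: "nat \<Rightarrow> 'a" and i
    assume sum: "(\<Sum>i<n. to_ac (c i) * w i) = 0" and i: "i < n"
    define u where "u = c \<circ> inv_into {..<n} w"
    have u: "u (w i) = c i" if "i < n" for i using * that by (simp add: u_def)
    have "(\<Sum>v\<in>w ` {..<n}. to_ac (u v) * v) = (\<Sum>i<n. to_ac (u (w i)) * w i)"
      using * by (simp add: sum.reindex)
    also have "\<dots> = 0" using sum by (simp add: u cong: sum.cong_simp)
    finally have "u (w i) = 0"
      using * i unfolding ac_vs.independent_explicit_finite_subsets by blast
    then show "c i = 0" using u i by simp
  qed
qed

lemma adjoin_subset_span: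
  assumes "is_min_poly M x"
  shows "adjoin x \<subseteq> ac_vs.span ((\<lambda>i. x ^ i) ` {..<Polynomial.degree M})"
proof
  fix y assume "y \<in> adjoin x"
  then obtain c where "y = (\<Sum>i<Polynomial.degree M. to_ac (c i) * x ^ i)"
    using adjoin_power_basis assms by blast
  then show "y \<in> ac_vs.span ((\<lambda>i. x ^ i) ` {..<Polynomial.degree M})"
    by (auto intro!: ac_vs.span_sum intro: ac_vs.span_scale[OF ac_vs.span_base])
qed

lemma power_in_adjoin: "x ^ i \<in> adjoin x"
  using aeval_in_adjoin[of x x "Polynomial.monom 1 i"] by (simp add: poly_monom)

lemma ext_degree_adjoin:
  assumes "is_min_poly M x"
  shows "ext_degree (adjoin x) = Polynomial.degree M"
proof -
  let ?B = "(\<lambda>i. x ^ i) ` {..<Polynomial.degree M}"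
  have "card ?B = ac_vs.dim (adjoin x)"
    using lin_indep_powers[OF assms] adjoin_subset_span[OF assms]
    by (intro ac_vs.basis_card_eq_dim) (auto simp: lin_indep_iff power_in_adjoin)
  then show ?thesis
    using lin_indepD_inj[OF lin_indep_powers[OF assms]] by (simp add: ext_degree_def card_image)
qed

text \<open>K(x) is spanned by finitely many powers of x, so the range of \<open>w\<close> extends
  to a finite basis \<open>B\<close>. Its new elements are enumerated from index r on, which keeps
  \<open>w\<close> as an initial segment.\<close>

lemma lin_indep_extend:
  assumes w: "lin_indep r w" and wx: "\<And>i. i < r \<Longrightarrow> w i \<in> adjoin x"
  shows "r \<le> ext_degree (adjoin x)"
    and "\<exists>w'. lin_indep (ext_degree (adjoin x)) w' \<and> (\<forall>i<r. w' i = w i) \<and>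
           (\<forall>i<ext_degree (adjoin x). w' i \<in> adjoin x)"
proof -
  let ?n = "ext_degree (adjoin x)"
  from w have inj: "inj_on w {..<r}" and ind: "\<not> ac_vs.dependent (w ` {..<r})"
    by (auto simp: lin_indep_iff)
  obtain M where M: "is_min_poly M x" using is_min_poly_exists by blast
  obtain B where B: "w ` {..<r} \<subseteq> B" "B \<subseteq> adjoin x" "\<not> ac_vs.dependent B" "adjoin x \<subseteq> ac_vs.span B"
    using ac_vs.maximal_independent_subset_extend[of "w ` {..<r}" "adjoin x"] wx ind by blast
  have "finite B"
    using ac_vs.independent_span_bound[of "(\<lambda>i. x ^ i) ` {..<Polynomial.degree M}" B]
      adjoin_subset_span[OF M] B by auto
  have card_B: "card B = ?n"
    using B ac_vs.basis_card_eq_dim by (auto simp: ext_degree_def)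
  show r: "r \<le> ?n"
    using card_mono[OF \<open>finite B\<close> B(1)] card_image[OF inj] card_B by simp
  have "card {r..<?n} = card (B - w ` {..<r})"
    using B(1) \<open>finite B\<close> card_image[OF inj] card_B by (simp add: card_Diff_subset)
  then obtain g where g: "bij_betw g {r..<?n} (B - w ` {..<r})"
    using finite_same_card_bij[of "{r..<?n}" "B - w ` {..<r}"] \<open>finite B\<close> by auto
  define w' where "w' i = (if i < r then w i else g i)" for i
  have "bij_betw w' ({..<r} \<union> {r..<?n}) (w ` {..<r} \<union> (B - w ` {..<r}))"
  proof (rule bij_betw_combine)
    show "bij_betw w' {..<r} (w ` {..<r})"
      using inj by (subst bij_betw_cong[of _ _ w]) (auto simp: w'_def bij_betw_def)
    show "bij_betw w' {r..<?n} (B - w ` {..<r})"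
      using g by (subst bij_betw_cong[of _ _ g]) (auto simp: w'_def)
  qed auto
  moreover have "{..<r} \<union> {r..<?n} = {..<?n}" "w ` {..<r} \<union> (B - w ` {..<r}) = B"
    using r B(1) by auto
  ultimately have bij: "bij_betw w' {..<?n} B" by simp
  then have "lin_indep ?n w'" using B(3) by (auto simp: lin_indep_iff bij_betw_def)
  moreover have "\<forall>i<?n. w' i \<in> adjoin x" using bij B(2) by (auto simp: bij_betw_def)
  ultimately show "\<exists>w'. lin_indep ?n w' \<and> (\<forall>i<r. w' i = w i) \<and> (\<forall>i<?n. w' i \<in> adjoin x)"
    by (intro exI[of _ w']) (auto simp: w'_def)
qed

text \<open>The coefficients of \<open>M / (t - x)\<close> in \<open>\<bbbK>(x)\<close>, by Horner's scheme.\<close>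

definition quot_coeff :: "'k::field poly \<Rightarrow> 'k alg_closure \<Rightarrow> nat \<Rightarrow> 'k alg_closure" where
  "quot_coeff M x i = aeval (poly_shift (Suc i) M) x"

text \<open>One step of Horner's scheme. At i = 0 the left side is M(x) itself.\<close>

lemma quot_coeff_rec:
  "aeval (poly_shift i M) x = to_ac (poly.coeff M i) + x * quot_coeff M x i"
proof -
  have "poly_shift i M = pCons (poly.coeff M i) (poly_shift (Suc i) M)"
    by (rule poly_eqI) (simp add: coeff_poly_shift coeff_pCons split: nat.splits)
  then show ?thesis by (simp add: quot_coeff_def)
qed

lemma quot_coeff_beyond: "Polynomial.degree M \<le> i \<Longrightarrow> quot_coeff M x i = 0"
proof -
  assume "Polynomial.degree M \<le> i"
  then have "poly_shift (Suc i) M = 0"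
    by (intro poly_eqI) (simp add: coeff_poly_shift coeff_eq_0)
  then show ?thesis by (simp add: quot_coeff_def)
qed

lemma quot_coeff_in_adjoin: "x \<in> adjoin y \<Longrightarrow> quot_coeff M x i \<in> adjoin y"
  by (simp add: quot_coeff_def aeval_in_adjoin)

text \<open>With m_i for \<open>quot_coeff M x i\<close>, coefficient k of the product is m_(k-1) -
  x m_k, which the Horner step identifies with that of M. At k = 0 the place of m_(-1) is taken by
  M(x) = 0.\<close>

lemma linear_factor_quot_coeff:
  assumes "aeval M x = 0"
  shows "[:- x, 1:] * (\<Sum>i<Polynomial.degree M. Polynomial.monom (quot_coeff M x i) i) = map_poly to_ac M"
    (is "_ * ?m = _")
proof (rule poly_eqI)
  fix k
  have m: "poly.coeff ?m j = quot_coeff M x j" for j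
    by (cases "j < Polynomial.degree M")
       (simp_all add: Polynomial.coeff_sum quot_coeff_beyond if_distrib sum.delta' cong: if_cong)
  show "poly.coeff ([:- x, 1:] * ?m) k = poly.coeff (map_poly to_ac M) k"
  proof (cases k)
    case 0
    then show ?thesis using quot_coeff_rec[of 0 M x] assms by (simp add: m add_eq_0_iff)
  next
    case (Suc j)
    then show ?thesis
      using quot_coeff_rec[of k M x] by (simp add: m quot_coeff_def[of M x j])
  qed
qed

text \<open>A relation makes \<open>p\<close>, a combination of shifts of \<open>M\<close>, vanish
  at x; its degree is below that of M, so p = 0. The shifts are monic of the distinct degrees r - 1,
  ..., 0, so the coefficients of the relation solve a triangular homogeneous system.\<close>

lemma lin_indep_quot_coeff:
  assumes M: "is_min_poly M x"
  shows "lin_indep (Polynomial.degree M) (quot_coeff M x)"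
  unfolding lin_indep_def
proof (intro allI impI)
  let ?r = "Polynomial.degree M"
  fix c :: "nat \<Rightarrow> 'a" and i
  assume sum: "(\<Sum>i<?r. to_ac (c i) * quot_coeff M x i) = 0" and i: "i < ?r"
  define p where "p = (\<Sum>i<?r. Polynomial.smult (c i) (poly_shift (Suc i) M))"
  have coeff: "poly.coeff p k = (\<Sum>i<?r. c i * poly.coeff M (k + Suc i))" for k
    by (simp add: p_def Polynomial.coeff_sum coeff_poly_shift)
  have deg: "Polynomial.degree p < ?r"
    using is_min_poly_degree_pos[OF M]
    by (intro Polynomial.degree_lessI) (auto simp: coeff coeff_eq_0)
  have "aeval p x = 0"
    using sum by (simp add: p_def to_ac_poly_hom.hom_sum poly_sum to_ac_hom.map_poly_hom_smult quot_coeff_def)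
  then have p0: "p = 0" using aeval_eq_0_small_degree[OF M deg] by blast
  show "c i = 0" using i
  proof (induction i rule: less_induct)
    case (less i)
    \<comment> \<open>This coefficient of p isolates \<open>c i\<close>: M is read at index r + j -
      i, where j < i meets a \<open>c j\<close> already known to vanish, j = i the leading
      coefficient 1, and j > i an index beyond the degree.\<close>
    have "0 = (\<Sum>j<?r. c j * poly.coeff M (?r - Suc i + Suc j))"
      using coeff[of "?r - Suc i"] p0 by simp
    also have "\<dots> = (\<Sum>j<?r. if j = i then c i else 0)"
    proof (rule sum.cong[OF refl])
      fix j assume j: "j \<in> {..<?r}"
      consider "j < i" | "j = i" | "j > i" by linarith
      then show "c j * poly.coeff M (?r - Suc i + Suc j) = (if j = i then c i else 0)"
      proof cases
        case 1 then show ?thesis using less j by simp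
      next
        case 2 then show ?thesis using less.prems M by (simp add: is_min_poly_def)
      next
        case 3 then show ?thesis using less.prems by (simp add: coeff_eq_0)
      qed
    qed
    also have "\<dots> = c i" using less.prems by simp
    finally show ?case by simp
  qed
qed

section \<open>Rational functions over the base field\<close>

lemma ratfuns_over_baseI: "q \<noteq> 0 \<Longrightarrow> f = Fract (map_poly to_ac p) (map_poly to_ac q) \<Longrightarrow> f \<in> ratfuns_over_base"
  unfolding ratfuns_over_base_def by blast

lemma ratfuns_over_baseE:
  assumes "f \<in> ratfuns_over_base"
  obtains p q where "q \<noteq> 0" "f = Fract (map_poly to_ac p) (map_poly to_ac q)"
  using assms unfolding ratfuns_over_base_def by blast

lemma ratfuns_over_base_const [simp]: "to_fract [:to_ac c:] \<in> ratfuns_over_base"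
  by (rule ratfuns_over_baseI[of 1 _ "[:c:]"]) (simp_all add: to_fract_def)

lemma ratfuns_over_base_0 [simp]: "0 \<in> ratfuns_over_base"
  using ratfuns_over_base_const[of 0] by simp

lemma ratfuns_over_base_add:
  assumes "f \<in> ratfuns_over_base" "g \<in> ratfuns_over_base"
  shows "f + g \<in> ratfuns_over_base"
proof -
  obtain p q where f: "q \<noteq> 0" "f = Fract (map_poly to_ac p) (map_poly to_ac q)"
    using assms(1) by (rule ratfuns_over_baseE)
  obtain p' q' where g: "q' \<noteq> 0" "g = Fract (map_poly to_ac p') (map_poly to_ac q')"
    using assms(2) by (rule ratfuns_over_baseE)
  show ?thesis
    using f g by (intro ratfuns_over_baseI[of "q * q'" _ "p * q' + p' * q"])
      (simp_all add: to_ac_poly_hom.hom_mult to_ac_poly_hom.hom_add)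
qed

lemma ratfuns_over_base_mult:
  assumes "f \<in> ratfuns_over_base" "g \<in> ratfuns_over_base"
  shows "f * g \<in> ratfuns_over_base"
proof -
  obtain p q where f: "q \<noteq> 0" "f = Fract (map_poly to_ac p) (map_poly to_ac q)"
    using assms(1) by (rule ratfuns_over_baseE)
  obtain p' q' where g: "q' \<noteq> 0" "g = Fract (map_poly to_ac p') (map_poly to_ac q')"
    using assms(2) by (rule ratfuns_over_baseE)
  show ?thesis
    using f g by (intro ratfuns_over_baseI[of "q * q'" _ "p * p'"])
      (simp_all add: to_ac_poly_hom.hom_mult)
qed

lemma ratfuns_over_base_sum:
  "(\<And>i. i \<in> I \<Longrightarrow> f i \<in> ratfuns_over_base) \<Longrightarrow> sum f I \<in> ratfuns_over_base"
  by (induction I rule: infinite_finite_induct) (auto intro: ratfuns_over_base_add)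

lemma ratfuns_over_base_diff:
  fixes f g :: "'a::field alg_closure poly fract"
  assumes "f \<in> ratfuns_over_base" "g \<in> ratfuns_over_base"
  shows "f - g \<in> ratfuns_over_base"
proof -
  have "[:to_ac (- 1):] = - (1 :: 'a alg_closure poly)" by (simp add: one_pCons)
  then have eq: "f - g = f + to_fract [:to_ac (- 1):] * g" by simp
  show ?thesis
    unfolding eq using assms
    by (intro ratfuns_over_base_add ratfuns_over_base_mult ratfuns_over_base_const)
qed

lemma ratfuns_over_base_common_denominator:
  fixes n :: nat
  assumes "\<And>i. i < n \<Longrightarrow> f i \<in> ratfuns_over_base"
  shows "\<exists>q p. q \<noteq> 0 \<and> (\<forall>i<n. f i = Fract (map_poly to_ac (p i)) (map_poly to_ac q))"
  using assms
proof (induction n)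
  case 0
  show ?case by (intro exI[of _ 1]) simp
next
  case (Suc n)
  then obtain q p where qp: "q \<noteq> 0" "\<forall>i<n. f i = Fract (map_poly to_ac (p i)) (map_poly to_ac q)"
    by fastforce
  obtain p' q' where f: "q' \<noteq> 0" "f n = Fract (map_poly to_ac p') (map_poly to_ac q')"
    using Suc.prems[of n] by (auto elim: ratfuns_over_baseE)
  show ?case
    using qp f
    by (intro exI[of _ "q * q'"] exI[of _ "\<lambda>i. if i < n then p i * q' else p' * q"])
       (auto simp: to_ac_poly_hom.hom_mult eq_fract less_Suc_eq)
qed

text \<open>Independence over K persists over K(t): after clearing a common denominator, the
  coefficients belonging to each power of t form a relation over K.\<close>

lemma ratfuns_over_base_lin_indep:
  assumes w: "lin_indep n w" and f: "\<And>i. i < n \<Longrightarrow> f i \<in> ratfuns_over_base"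
    and sum: "(\<Sum>i<n. f i * to_fract [:w i:]) = 0" and i: "i < n"
  shows "f i = 0"
proof -
  obtain q p where q: "q \<noteq> 0" and f_eq: "\<And>i. i < n \<Longrightarrow> f i = Fract (map_poly to_ac (p i)) (map_poly to_ac q)"
    using ratfuns_over_base_common_denominator[of n f, OF f] by metis
  have "to_fract (map_poly to_ac q) * f i = to_fract (map_poly to_ac (p i))" if "i < n" for i
    using f_eq[OF that] q by (simp add: to_fract_def eq_fract)
  then have "to_fract (\<Sum>i<n. map_poly to_ac (p i) * [:w i:])
      = (\<Sum>i<n. to_fract (map_poly to_ac q) * f i * to_fract [:w i:])"
    by (simp add: to_fract_sum del: mult_pCons_right)
  also have "\<dots> = 0"
    using sum by (simp add: mult.assoc flip: sum_distrib_left)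
  finally have *: "(\<Sum>i<n. map_poly to_ac (p i) * [:w i:]) = 0"
    by (simp only: to_fract_eq_0_iff)
  have "poly.coeff (p i) k = 0" for k
  proof -
    have "(\<Sum>i<n. to_ac (poly.coeff (p i) k) * w i) = poly.coeff (\<Sum>i<n. map_poly to_ac (p i) * [:w i:]) k"
      by (simp add: Polynomial.coeff_sum mult.commute)
    then have "(\<Sum>i<n. to_ac (poly.coeff (p i) k) * w i) = 0" using * by simp
    then show ?thesis
      using w i unfolding lin_indep_def by (elim allE[of _ "\<lambda>i. poly.coeff (p i) k"]) simp
  qed
  then have "p i = 0" by (intro poly_eqI) simp
  then show ?thesis using f_eq[OF i] by (simp add: fract_collapse)
qed

text \<open>The definite description has at most one solution, because the difference of two is a
  relation over K(t) between powers of \<alpha>. The zeros beyond the degree pin down the function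
  at the remaining indices.\<close>

lemma alpha_components_eqI:
  assumes ind: "lin_indep (ext_degree (adjoin \<alpha>)) (\<lambda>i. \<alpha> ^ i)"
    and \<phi>: "\<And>i. i < ext_degree (adjoin \<alpha>) \<Longrightarrow> \<phi> i \<in> ratfuns_over_base"
      "\<And>i. i \<ge> ext_degree (adjoin \<alpha>) \<Longrightarrow> \<phi> i = 0"
    and u: "u = (\<Sum>i < ext_degree (adjoin \<alpha>). \<phi> i * to_fract [:\<alpha> ^ i:])"
  shows "alpha_components \<alpha> u = \<phi>"
proof -
  have pow: "to_fract [:\<alpha>:] ^ i = to_fract [:\<alpha> ^ i:]" for i
    by (induction i) (simp_all add: one_pCons[symmetric] flip: to_fract_mult)
  show ?thesis
    unfolding alpha_components_def pow
  proof (rule the_equality)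
    fix \<psi>
    assume \<psi>: "(\<forall>i<ext_degree (adjoin \<alpha>). \<psi> i \<in> ratfuns_over_base) \<and>
      (\<forall>i\<ge>ext_degree (adjoin \<alpha>). \<psi> i = 0) \<and>
      u = (\<Sum>i<ext_degree (adjoin \<alpha>). \<psi> i * to_fract [:\<alpha> ^ i:])"
    have "\<psi> i - \<phi> i = 0" if "i < ext_degree (adjoin \<alpha>)" for i
      using ind _ _ that
    proof (rule ratfuns_over_base_lin_indep)
      show "(\<Sum>i<ext_degree (adjoin \<alpha>). (\<psi> i - \<phi> i) * to_fract [:\<alpha> ^ i:]) = 0"
        using u \<psi> by (simp add: left_diff_distrib sum_subtractf)
    qed (use \<psi> \<phi> in \<open>auto intro: ratfuns_over_base_diff\<close>)
    then have "\<psi> i = \<phi> i" for i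
      using \<psi> \<phi>(2) by (cases "i < ext_degree (adjoin \<alpha>)") auto
    then show "\<psi> = \<phi>" by (rule ext)
  qed (use \<phi> u in auto)
qed

text \<open>Poles and values are defined through lowest terms, yet can be read off any
  representation whose denominator is nonzero at t: the reduced denominator divides every other
  one.\<close>

lemma ratfun_defined_eval_iff:
  "ratfun_defined f t \<and> ratfun_eval f t = y \<longleftrightarrow>
     (\<exists>p q. f = Fract p q \<and> poly q t \<noteq> 0 \<and> y = poly p t / poly q t)"
proof
  assume "ratfun_defined f t \<and> ratfun_eval f t = y"
  then show "\<exists>p q. f = Fract p q \<and> poly q t \<noteq> 0 \<and> y = poly p t / poly q t"
    by (intro exI[of _ "fst (quot_of_fract f)"] exI[of _ "snd (quot_of_fract f)"])
       (auto simp: ratfun_defined_def ratfun_eval_def)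
next
  assume "\<exists>p q. f = Fract p q \<and> poly q t \<noteq> 0 \<and> y = poly p t / poly q t"
  then obtain p q where pq: "f = Fract p q" "poly q t \<noteq> 0" "y = poly p t / poly q t" by blast
  define a b where "a = fst (quot_of_fract f)" and "b = snd (quot_of_fract f)"
  have b0: "b \<noteq> 0" and q0: "q \<noteq> 0" using pq(2) by (auto simp: b_def)
  have "Fract a b = Fract p q" using pq(1) by (simp add: a_def b_def)
  then have eq: "a * q = p * b" using b0 q0 by (simp add: eq_fract)
  have "coprime a b" by (simp add: a_def b_def coprime_quot_of_fract)
  then have "b dvd q"
    using eq by (metis coprime_commute coprime_dvd_mult_right_iff dvd_triv_right)
  then have bt: "poly b t \<noteq> 0" using pq(2) by (auto elim!: dvdE)
  have "poly a t * poly q t = poly p t * poly b t"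
    using arg_cong[OF eq, of "\<lambda>p. poly p t"] by simp
  then have "poly a t * poly q t = (y * poly b t) * poly q t" using pq(2,3) by simp
  then have "poly a t = y * poly b t" using pq(2) by simp
  then show "ratfun_defined f t \<and> ratfun_eval f t = y"
    using bt by (simp add: ratfun_defined_def ratfun_eval_def a_def[symmetric] b_def[symmetric] field_simps)
qed

lemma ratfun_Fract:
  assumes "poly q t \<noteq> 0"
  shows "ratfun_defined (Fract p q) t" "ratfun_eval (Fract p q) t = poly p t / poly q t"
  using assms ratfun_defined_eval_iff[of "Fract p q" t "poly p t / poly q t"] by blast+

lemma ratfun_const [simp]: "ratfun_defined (to_fract [:c:]) t" "ratfun_eval (to_fract [:c:]) t = c"
  by (simp_all add: ratfun_defined_def ratfun_eval_def)

lemma ratfun_0 [simp]: "ratfun_defined 0 t" "ratfun_eval 0 t = 0"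
  by (simp_all add: ratfun_defined_def ratfun_eval_def)

lemma ratfun_add:
  assumes "ratfun_defined f t" "ratfun_defined g t"
  shows "ratfun_defined (f + g) t" "ratfun_eval (f + g) t = ratfun_eval f t + ratfun_eval g t"
proof -
  obtain p q where f: "f = Fract p q" "poly q t \<noteq> 0" "ratfun_eval f t = poly p t / poly q t"
    using assms(1) ratfun_defined_eval_iff by metis
  obtain p' q' where g: "g = Fract p' q'" "poly q' t \<noteq> 0" "ratfun_eval g t = poly p' t / poly q' t"
    using assms(2) ratfun_defined_eval_iff by metis
  have "q \<noteq> 0" "q' \<noteq> 0" using f g by auto
  then have "f + g = Fract (p * q' + p' * q) (q * q')" using f g by simp
  moreover have "poly (q * q') t \<noteq> 0" using f g by simp
  ultimately show "ratfun_defined (f + g) t" "ratfun_eval (f + g) t = ratfun_eval f t + ratfun_eval g t"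
    using f g by (simp_all add: ratfun_Fract add_frac_eq)
qed

lemma ratfun_mult:
  assumes "ratfun_defined f t" "ratfun_defined g t"
  shows "ratfun_defined (f * g) t" "ratfun_eval (f * g) t = ratfun_eval f t * ratfun_eval g t"
proof -
  obtain p q where f: "f = Fract p q" "poly q t \<noteq> 0" "ratfun_eval f t = poly p t / poly q t"
    using assms(1) ratfun_defined_eval_iff by metis
  obtain p' q' where g: "g = Fract p' q'" "poly q' t \<noteq> 0" "ratfun_eval g t = poly p' t / poly q' t"
    using assms(2) ratfun_defined_eval_iff by metis
  have "q \<noteq> 0" "q' \<noteq> 0" using f g by auto
  then have "f * g = Fract (p * p') (q * q')" using f g by simp
  moreover have "poly (q * q') t \<noteq> 0" using f g by simp
  ultimately show "ratfun_defined (f * g) t" "ratfun_eval (f * g) t = ratfun_eval f t * ratfun_eval g t"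
    using f g by (simp_all add: ratfun_Fract)
qed

lemma ratfun_sum:
  assumes "\<And>i. i \<in> I \<Longrightarrow> ratfun_defined (f i) t"
  shows "ratfun_defined (sum f I) t \<and> ratfun_eval (sum f I) t = (\<Sum>i\<in>I. ratfun_eval (f i) t)"
  using assms by (induction I rule: infinite_finite_induct) (auto simp: ratfun_add)

text \<open>Constants have no poles, so the domain of \<open>g\<close> is contained in that of
  \<open>f\<close>. Applied to the inverse relation as well, this gives equality of the
  domains.\<close>

lemma ratfun_eval_affine:
  fixes A :: "'k::field alg_closure mat" and b :: "'k alg_closure vec"
  assumes A: "A \<in> carrier_mat n n" "b \<in> carrier_vec n"
    and f: "\<And>i. i < n \<Longrightarrow> f i = to_fract [:b $ i:] + (\<Sum>j<n. to_fract [:A $$ (i, j):] * g j)"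
    and g: "\<And>j. j < n \<Longrightarrow> ratfun_defined (g j) t"
  shows "\<forall>i<n. ratfun_defined (f i) t"
    "vec n (\<lambda>i. ratfun_eval (f i) t) = A *\<^sub>v vec n (\<lambda>i. ratfun_eval (g i) t) + b"
proof -
  have *: "ratfun_defined (f i) t \<and>
      ratfun_eval (f i) t = b $ i + (\<Sum>j<n. A $$ (i, j) * ratfun_eval (g j) t)" if "i < n" for i
    using g f[OF that] ratfun_sum[of "{..<n}" "\<lambda>j. to_fract [:A $$ (i, j):] * g j" t]
    by (auto simp: ratfun_add ratfun_mult)
  then show "\<forall>i<n. ratfun_defined (f i) t" by blast
  show "vec n (\<lambda>i. ratfun_eval (f i) t) = A *\<^sub>v vec n (\<lambda>i. ratfun_eval (g i) t) + b"
    using * A by (intro eq_vecI) (auto simp: scalar_prod_def atLeast0LessThan)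
qed

section \<open>Zariski closure\<close>

lemma poly_fun_sum:
  "finite I \<Longrightarrow> (\<And>i. i \<in> I \<Longrightarrow> poly_fun n (f i)) \<Longrightarrow> poly_fun n (\<lambda>v. \<Sum>i\<in>I. f i v)"
  by (induction I rule: finite_induct) (auto intro: poly_fun.intros)

lemma poly_fun_affine: "poly_fun n (\<lambda>v. c + (\<Sum>j<n. a j * v $ j))"
  by (intro poly_fun.add poly_fun.const poly_fun_sum poly_fun.mult) (auto intro: poly_fun.coord)

lemma hom_poly_fun_linear: "hom_poly_fun (Suc n) 1 (\<lambda>v. \<Sum>j<Suc n. a j * v $ j)"
proof -
  have "hom_poly_fun (Suc n) 1 (\<lambda>v. \<Sum>j<m. a j * v $ j)" if "m \<le> Suc n" for m
    using that
  proof (induction m)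
    case 0
    then show ?case
      \<comment> \<open>The zero form is needed in degree 1, but constants have degree 0; hence it
        is written as 0 times a coordinate.\<close>
      using hom_poly_fun.mult[OF hom_poly_fun.const[of "Suc n" 0] hom_poly_fun.coord[of 0 "Suc n"]] by simp
  next
    case (Suc m)
    then have "hom_poly_fun (Suc n) 1 (\<lambda>v. a m * v $ m)"
      using hom_poly_fun.mult[OF hom_poly_fun.const[of "Suc n" "a m"] hom_poly_fun.coord[of m "Suc n"]] by simp
    then show ?case using Suc by (auto intro: hom_poly_fun.add)
  qed
  from this[OF order_refl] show ?thesis .
qed

lemma hom_poly_fun_diff:
  assumes "hom_poly_fun m d f" "hom_poly_fun m d g"
  shows "hom_poly_fun m d (\<lambda>v. f v - g v)"
proof -
  have "hom_poly_fun m d (\<lambda>v. - 1 * g v)"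
    using hom_poly_fun.mult[OF hom_poly_fun.const[of m "- 1"] assms(2)] by simp
  from hom_poly_fun.add[OF assms(1) this] show ?thesis by simp
qed

lemma hom_poly_fun_imp_poly_fun: "hom_poly_fun m d f \<Longrightarrow> poly_fun m f"
  by (induction rule: hom_poly_fun.induct) (auto intro: poly_fun.intros)

lemma hom_poly_fun_smult:
  "hom_poly_fun m d f \<Longrightarrow> v \<in> carrier_vec m \<Longrightarrow> f (c \<cdot>\<^sub>v v) = c ^ d * f v"
  by (induction rule: hom_poly_fun.induct) (auto simp: algebra_simps power_add)

text \<open>Agreement is asked on \<open>D\<close> only: a coordinate of a matrix-vector product is
  the expected polynomial only on vectors of the right length.\<close>

lemma poly_fun_comp:
  assumes f: "poly_fun m f"
    and \<phi>: "\<And>i. i < m \<Longrightarrow> \<exists>g. poly_fun n g \<and> (\<forall>v\<in>D. g v = \<phi> v $ i)"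
  shows "\<exists>g. poly_fun n g \<and> (\<forall>v\<in>D. g v = f (\<phi> v))"
  using f
proof (induction rule: poly_fun.induct)
  case (const c)
  show ?case by (intro exI[of _ "\<lambda>v. c"]) (simp add: poly_fun.const)
next
  case (coord i)
  then show ?case by (rule \<phi>)
next
  case (add f g)
  then obtain f' g' where "poly_fun n f'" "\<forall>v\<in>D. f' v = f (\<phi> v)" "poly_fun n g'" "\<forall>v\<in>D. g' v = g (\<phi> v)"
    by blast
  then show ?case by (intro exI[of _ "\<lambda>v. f' v + g' v"]) (simp add: poly_fun.add)
next
  case (mult f g)
  then obtain f' g' where "poly_fun n f'" "\<forall>v\<in>D. f' v = f (\<phi> v)" "poly_fun n g'" "\<forall>v\<in>D. g' v = g (\<phi> v)"
    by blast
  then show ?case by (intro exI[of _ "\<lambda>v. f' v * g' v"]) (simp add: poly_fun.mult)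
qed

lemma hom_poly_fun_comp:
  assumes f: "hom_poly_fun m d f"
    and \<phi>: "\<And>i. i < m \<Longrightarrow> \<exists>g. hom_poly_fun n 1 g \<and> (\<forall>v\<in>D. g v = \<phi> v $ i)"
  shows "\<exists>g. hom_poly_fun n d g \<and> (\<forall>v\<in>D. g v = f (\<phi> v))"
  using f
proof (induction rule: hom_poly_fun.induct)
  case (const c)
  show ?case by (intro exI[of _ "\<lambda>v. c"]) (simp add: hom_poly_fun.const)
next
  case (coord i)
  then show ?case by (rule \<phi>)
next
  case (add d f g)
  then obtain f' g' where "hom_poly_fun n d f'" "\<forall>v\<in>D. f' v = f (\<phi> v)"
    "hom_poly_fun n d g'" "\<forall>v\<in>D. g' v = g (\<phi> v)"
    by blast
  then show ?case by (intro exI[of _ "\<lambda>v. f' v + g' v"]) (simp add: hom_poly_fun.add)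
next
  case (mult d f e g)
  then obtain f' g' where "hom_poly_fun n d f'" "\<forall>v\<in>D. f' v = f (\<phi> v)"
    "hom_poly_fun n e g'" "\<forall>v\<in>D. g' v = g (\<phi> v)"
    by blast
  then show ?case by (intro exI[of _ "\<lambda>v. f' v * g' v"]) (simp add: hom_poly_fun.mult)
qed

text \<open>Turns vanishing along a curve into a statement about one polynomial in one variable,
  whose roots can be counted.\<close>

lemma poly_fun_along_poly_curve:
  assumes f: "poly_fun m f" and p: "\<And>i t. i < m \<Longrightarrow> v t $ i = poly (p i) t"
  shows "\<exists>q. \<forall>t. f (v t) = poly q t"
  using f
proof (induction rule: poly_fun.induct)
  case (const c)
  show ?case by (intro exI[of _ "[:c:]"]) simp
next
  case (coord i)
  then show ?case using p by blast
next
  case (add f g)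
  then show ?case by (metis poly_add)
next
  case (mult f g)
  then show ?case by (metis poly_mult)
qed

section \<open>Closed sets of affine space and hulls\<close>

lemma zariski_closed_carrier: "zariski_closed n (carrier_vec n)"
  unfolding zariski_closed_def by (intro exI[of _ "{}"]) auto

text \<open>The empty intersection is excluded because it is the whole type, which contains vectors
  of every length.\<close>

lemma zariski_closed_Inter:
  assumes "\<T> \<noteq> {}" "\<And>Z. Z \<in> \<T> \<Longrightarrow> zariski_closed n Z"
  shows "zariski_closed n (\<Inter>\<T>)"
proof -
  have "\<forall>Z\<in>\<T>. \<exists>S. (\<forall>f\<in>S. poly_fun n f) \<and> Z = {x \<in> carrier_vec n. \<forall>f\<in>S. f x = 0}"
    using assms(2) unfolding zariski_closed_def by blast
  from bchoice[OF this] obtain S where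
    S: "\<forall>Z\<in>\<T>. (\<forall>f\<in>S Z. poly_fun n f) \<and> Z = {x \<in> carrier_vec n. \<forall>f\<in>S Z. f x = 0}" ..
  have mem: "x \<in> Z \<longleftrightarrow> x \<in> carrier_vec n \<and> (\<forall>f\<in>S Z. f x = 0)" if "Z \<in> \<T>" for x Z
    by (subst conjunct2[OF bspec[OF S that]]) simp
  have "\<Inter>\<T> = {x \<in> carrier_vec n. \<forall>f\<in>\<Union>(S ` \<T>). f x = 0}"
    using assms(1) by (auto simp: mem)
  moreover have "\<forall>f\<in>\<Union>(S ` \<T>). poly_fun n f"
    using S by blast
  ultimately show ?thesis
    unfolding zariski_closed_def by (intro exI[of _ "\<Union>(S ` \<T>)"] conjI)
qed

lemma zariski_closed_vimage:
  assumes Z: "zariski_closed m Z"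
    and \<phi>: "\<And>v. v \<in> carrier_vec n \<Longrightarrow> \<phi> v \<in> carrier_vec m"
      "\<And>i. i < m \<Longrightarrow> \<exists>g. poly_fun n g \<and> (\<forall>v\<in>carrier_vec n. g v = \<phi> v $ i)"
  shows "zariski_closed n {x \<in> carrier_vec n. \<phi> x \<in> Z}"
proof -
  obtain S where S: "\<And>f. f \<in> S \<Longrightarrow> poly_fun m f" "Z = {x \<in> carrier_vec m. \<forall>f\<in>S. f x = 0}"
    using Z unfolding zariski_closed_def by blast
  obtain G where G: "\<And>f. f \<in> S \<Longrightarrow> poly_fun n (G f) \<and> (\<forall>v\<in>carrier_vec n. G f v = f (\<phi> v))"
    using poly_fun_comp[OF S(1) \<phi>(2)] by metis
  show ?thesis
    unfolding zariski_closed_def using S(2) G \<phi>(1) by (intro exI[of _ "G ` S"]) auto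
qed

text \<open>The hull intersects all P-sets above \<open>Y\<close>, and \<open>D\<close> is one of
  them; so stability under nonempty intersections is enough.\<close>

lemma hull_in_nonempty:
  assumes "\<And>\<T>. \<T> \<noteq> {} \<Longrightarrow> (\<And>Z. Z \<in> \<T> \<Longrightarrow> P Z) \<Longrightarrow> P (\<Inter>\<T>)" and "P D" "Y \<subseteq> D"
  shows "P (P hull Y)"
  unfolding hull_def by (rule assms(1)) (use assms(2,3) in auto)

text \<open>Each inclusion is the minimality of a hull: the preimage of one closure is closed and
  contains the set that generates the other. \<open>P\<close> is abstract so that affine and
  projective space share the argument.\<close>

lemma image_hull_homeomorphism:
  assumes D: "P D" and sub: "\<And>Z. P Z \<Longrightarrow> Z \<subseteq> D" and Y: "Y \<subseteq> D"
    and closed: "\<And>\<T>. \<T> \<noteq> {} \<Longrightarrow> (\<And>Z. Z \<in> \<T> \<Longrightarrow> P Z) \<Longrightarrow> P (\<Inter>\<T>)"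
    and inv: "\<And>x. x \<in> D \<Longrightarrow> f x \<in> D \<and> g (f x) = x" "\<And>x. x \<in> D \<Longrightarrow> g x \<in> D \<and> f (g x) = x"
    and cont: "\<And>Z. P Z \<Longrightarrow> P {x \<in> D. f x \<in> Z}" "\<And>Z. P Z \<Longrightarrow> P {x \<in> D. g x \<in> Z}"
  shows "f ` (P hull Y) = P hull (f ` Y)"
proof
  have YX: "P hull Y \<subseteq> D" by (rule hull_minimal[where S=P]) (use D Y in auto)
  have fYX: "f ` Y \<subseteq> D" using inv Y by blast
  have "P hull Y \<subseteq> {x \<in> D. f x \<in> P hull (f ` Y)}"
  proof (rule hull_minimal)
    show "Y \<subseteq> {x \<in> D. f x \<in> P hull (f ` Y)}" using Y hull_subset[of "f ` Y" P] by auto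
    show "P {x \<in> D. f x \<in> P hull (f ` Y)}"
      by (rule cont, rule hull_in_nonempty[of P D]) (use closed D fYX in auto)
  qed
  then show "f ` (P hull Y) \<subseteq> P hull (f ` Y)" by auto
  have "P hull (f ` Y) \<subseteq> {x \<in> D. g x \<in> P hull Y}"
  proof (rule hull_minimal)
    show "f ` Y \<subseteq> {x \<in> D. g x \<in> P hull Y}"
      using Y inv hull_subset[of Y P] by force
    show "P {x \<in> D. g x \<in> P hull Y}"
      by (rule cont, rule hull_in_nonempty[of P D]) (use closed D Y in auto)
  qed
  then show "P hull (f ` Y) \<subseteq> f ` (P hull Y)" using inv by force
qed

lemma zariski_closed_subset: "zariski_closed n Z \<Longrightarrow> Z \<subseteq> carrier_vec n"
  by (auto simp: zariski_closed_def)

lemma mat_mult_vec_index: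
  assumes "A \<in> carrier_mat n m" "v \<in> carrier_vec m" "i < n"
  shows "(A *\<^sub>v v) $ i = (\<Sum>j<m. A $$ (i, j) * v $ j)"
  using assms by (simp add: scalar_prod_def atLeast0LessThan)

lemma affine_image_zariski_closure:
  fixes A B :: "'a::field mat"
  assumes carrier: "A \<in> carrier_mat n n" "B \<in> carrier_mat n n" "a \<in> carrier_vec n" "b \<in> carrier_vec n"
    and inv: "\<And>x. x \<in> carrier_vec n \<Longrightarrow> B *\<^sub>v (A *\<^sub>v x + a) + b = x"
      "\<And>x. x \<in> carrier_vec n \<Longrightarrow> A *\<^sub>v (B *\<^sub>v x + b) + a = x"
    and Y: "Y \<subseteq> carrier_vec n"
  shows "(\<lambda>x. A *\<^sub>v x + a) ` zariski_closure n Y = zariski_closure n ((\<lambda>x. A *\<^sub>v x + a) ` Y)"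
proof -
  have cont: "zariski_closed n {x \<in> carrier_vec n. C *\<^sub>v x + c \<in> Z}"
    if "zariski_closed n Z" "C \<in> carrier_mat n n" "c \<in> carrier_vec n" for C c Z
  proof (rule zariski_closed_vimage[OF that(1)])
    fix i assume i: "i < n"
    show "\<exists>g. poly_fun n g \<and> (\<forall>v\<in>carrier_vec n. g v = (C *\<^sub>v v + c) $ i)"
      using that i
      by (intro exI[of _ "\<lambda>v. c $ i + (\<Sum>j<n. C $$ (i, j) * v $ j)"])
         (auto simp: poly_fun_affine mat_mult_vec_index simp del: index_mult_mat_vec)
  qed (use that in auto)
  show ?thesis
    unfolding zariski_closure_def
    by (rule image_hull_homeomorphism[where D="carrier_vec n" and g="\<lambda>x. B *\<^sub>v x + b"])
       (use carrier inv Y cont in \<open>auto simp: zariski_closed_carrier zariski_closed_subset zariski_closed_Inter\<close>)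
qed

section \<open>Points and closed sets of projective space\<close>

lemma proj_point_iff:
  assumes "v \<in> carrier_vec m"
  shows "proj_point v = proj_point w \<longleftrightarrow> (\<exists>c. c \<noteq> 0 \<and> v = c \<cdot>\<^sub>v w)"
proof
  assume "proj_point v = proj_point w"
  moreover have "v \<in> proj_point v" by (auto simp: proj_point_def intro: exI[of _ 1])
  ultimately show "\<exists>c. c \<noteq> 0 \<and> v = c \<cdot>\<^sub>v w" by (auto simp: proj_point_def)
next
  assume "\<exists>c. c \<noteq> 0 \<and> v = c \<cdot>\<^sub>v w"
  then obtain c where c: "c \<noteq> 0" "v = c \<cdot>\<^sub>v w" by blast
  have "\<exists>e. d \<cdot>\<^sub>v w = e \<cdot>\<^sub>v v \<and> e \<noteq> 0" if "d \<noteq> 0" for d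
    using c that by (intro exI[of _ "d / c"]) (simp add: smult_smult_assoc)
  then show "proj_point v = proj_point w"
    using c by (auto simp: proj_point_def smult_smult_assoc)
qed

lemma proj_point_in_proj_space:
  assumes "v \<in> carrier_vec (Suc n)" "v \<noteq> 0\<^sub>v (Suc n)"
  shows "proj_point v \<in> proj_space n"
  using assms by (auto simp: proj_space_def)

text \<open>A form of degree d scales by c^d, so one representative decides about the whole
  point.\<close>

lemma hom_poly_fun_proj_point:
  assumes "hom_poly_fun m d f" "v \<in> carrier_vec m"
  shows "(\<forall>w\<in>proj_point v. f w = 0) \<longleftrightarrow> f v = 0"
proof
  assume *: "\<forall>w\<in>proj_point v. f w = 0"
  have "v \<in> proj_point v" by (auto simp: proj_point_def intro: exI[of _ 1])
  then show "f v = 0" using * by blast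
qed (auto simp: proj_point_def hom_poly_fun_smult[OF assms])

lemma proj_zariski_closed_space: "proj_zariski_closed n (proj_space n)"
  unfolding proj_zariski_closed_def by (intro exI[of _ "{}"]) auto

lemma proj_zariski_closed_subset: "proj_zariski_closed n Z \<Longrightarrow> Z \<subseteq> proj_space n"
  by (auto simp: proj_zariski_closed_def)

lemma proj_zariski_closed_Inter:
  assumes "\<T> \<noteq> {}" "\<And>Z. Z \<in> \<T> \<Longrightarrow> proj_zariski_closed n Z"
  shows "proj_zariski_closed n (\<Inter>\<T>)"
proof -
  have "\<forall>Z\<in>\<T>. \<exists>S. (\<forall>f\<in>S. \<exists>d. hom_poly_fun (Suc n) d f) \<and>
      Z = {P \<in> proj_space n. \<forall>f\<in>S. \<forall>v\<in>P. f v = 0}"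
    using assms(2) unfolding proj_zariski_closed_def by blast
  from bchoice[OF this] obtain S where
    S: "\<forall>Z\<in>\<T>. (\<forall>f\<in>S Z. \<exists>d. hom_poly_fun (Suc n) d f) \<and>
      Z = {P \<in> proj_space n. \<forall>f\<in>S Z. \<forall>v\<in>P. f v = 0}" ..
  have mem: "P \<in> Z \<longleftrightarrow> P \<in> proj_space n \<and> (\<forall>f\<in>S Z. \<forall>v\<in>P. f v = 0)" if "Z \<in> \<T>" for P Z
    by (subst conjunct2[OF bspec[OF S that]]) simp
  have "\<Inter>\<T> = {P \<in> proj_space n. \<forall>f\<in>\<Union>(S ` \<T>). \<forall>v\<in>P. f v = 0}"
    using assms(1) by (auto simp: mem)
  moreover have "\<forall>f\<in>\<Union>(S ` \<T>). \<exists>d. hom_poly_fun (Suc n) d f"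
    using S by blast
  ultimately show ?thesis
    unfolding proj_zariski_closed_def by (intro exI[of _ "\<Union>(S ` \<T>)"] conjI)
qed

text \<open>Moves the membership test from all representatives of a point to a single one;
  \<open>proj_zariski_closedI\<close> is the way back.\<close>

lemma proj_zariski_closedD:
  assumes "proj_zariski_closed n Z"
  shows "\<exists>S. (\<forall>f\<in>S. \<exists>d. hom_poly_fun (Suc n) d f) \<and>
    (\<forall>v\<in>carrier_vec (Suc n). v \<noteq> 0\<^sub>v (Suc n) \<longrightarrow>
       (proj_point v \<in> Z \<longleftrightarrow> (\<forall>f\<in>S. f v = 0)))"
proof -
  obtain S where S: "\<forall>f\<in>S. \<exists>d. hom_poly_fun (Suc n) d f"
    "Z = {P \<in> proj_space n. \<forall>f\<in>S. \<forall>v\<in>P. f v = 0}"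
    using assms unfolding proj_zariski_closed_def by blast
  have "proj_point v \<in> Z \<longleftrightarrow> (\<forall>f\<in>S. f v = 0)"
    if v: "v \<in> carrier_vec (Suc n)" "v \<noteq> 0\<^sub>v (Suc n)" for v
  proof -
    have "(\<forall>w\<in>proj_point v. f w = 0) \<longleftrightarrow> f v = 0" if "f \<in> S" for f
      using S(1) that hom_poly_fun_proj_point[OF _ v(1)] by blast
    then show ?thesis using proj_point_in_proj_space[OF v] by (simp add: S(2))
  qed
  with S(1) show ?thesis by (intro exI[of _ S]) simp
qed

lemma proj_zariski_closedI:
  assumes "\<And>f. f \<in> S \<Longrightarrow> \<exists>d. hom_poly_fun (Suc n) d f" and "Z \<subseteq> proj_space n"
    and "\<And>v. v \<in> carrier_vec (Suc n) \<Longrightarrow> v \<noteq> 0\<^sub>v (Suc n) \<Longrightarrow>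
       proj_point v \<in> Z \<longleftrightarrow> (\<forall>f\<in>S. f v = 0)"
  shows "proj_zariski_closed n Z"
proof -
  have "P \<in> Z \<longleftrightarrow> P \<in> proj_space n \<and> (\<forall>f\<in>S. \<forall>v\<in>P. f v = 0)" for P
  proof (cases "P \<in> proj_space n")
    case True
    then obtain v where v: "P = proj_point v" "v \<in> carrier_vec (Suc n)" "v \<noteq> 0\<^sub>v (Suc n)"
      by (auto simp: proj_space_def)
    have "(\<forall>w\<in>proj_point v. f w = 0) \<longleftrightarrow> f v = 0" if "f \<in> S" for f
      using assms(1)[OF that] hom_poly_fun_proj_point[OF _ v(2)] by blast
    then show ?thesis using True assms(3)[OF v(2,3)] by (simp add: v(1))
  qed (use assms(2) in auto)
  then show ?thesis
    unfolding proj_zariski_closed_def using assms(1) by (intro exI[of _ S]) blast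
qed

text \<open>The forms cutting out the projective closure of \<open>Y\<close> become polynomials on
  setting the coordinate 0 to 1. Their affine zero set is closed and contains \<open>Y\<close>,
  hence also the affine closure of \<open>Y\<close>.\<close>

lemma proj_closure_zariski_closure:
  assumes Y: "Y \<subseteq> carrier_vec n"
  shows "proj_closure n (zariski_closure n Y) = proj_closure n (Y :: 'a::field vec set)"
proof
  let ?emb = "\<lambda>x::'a vec. proj_point (vCons 1 x)"
  have vCons: "vCons 1 x \<in> carrier_vec (Suc n)" "vCons 1 x \<noteq> 0\<^sub>v (Suc n)"
    if "x \<in> carrier_vec n" for x :: "'a vec"
  proof -
    show "vCons 1 x \<in> carrier_vec (Suc n)" using that by simp
    have "vCons 1 x $ 0 \<noteq> 0\<^sub>v (Suc n) $ 0" by simp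
    then show "vCons 1 x \<noteq> 0\<^sub>v (Suc n)" by metis
  qed
  show "proj_closure n Y \<subseteq> proj_closure n (zariski_closure n Y)"
    unfolding proj_closure_def zariski_closure_def by (intro hull_mono image_mono hull_subset)
  have closed: "proj_zariski_closed n (proj_closure n Y)"
    unfolding proj_closure_def
    by (rule hull_in_nonempty[of _ "proj_space n"])
       (use Y in \<open>auto intro!: proj_zariski_closed_space proj_zariski_closed_Inter
          proj_point_in_proj_space vCons\<close>)
  obtain S where S_all: "\<forall>f\<in>S. \<exists>d. hom_poly_fun (Suc n) d f"
    "\<forall>v\<in>carrier_vec (Suc n). v \<noteq> 0\<^sub>v (Suc n) \<longrightarrow> (proj_point v \<in> proj_closure n Y \<longleftrightarrow> (\<forall>f\<in>S. f v = 0))"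
    using proj_zariski_closedD[OF closed] by blast
  note S = S_all[rule_format]
  have "zariski_closed (Suc n) {v \<in> carrier_vec (Suc n). \<forall>f\<in>S. f v = 0}"
    unfolding zariski_closed_def
    by (intro exI[of _ S] conjI ballI refl) (use S(1) hom_poly_fun_imp_poly_fun in blast)
  then have "zariski_closed n {x \<in> carrier_vec n. vCons 1 x \<in> {v \<in> carrier_vec (Suc n). \<forall>f\<in>S. f v = 0}}"
  proof (rule zariski_closed_vimage)
    fix i assume "i < Suc n"
    then show "\<exists>g. poly_fun n g \<and> (\<forall>v\<in>carrier_vec n. g v = vCons 1 v $ i)"
      by (cases i) (auto intro: poly_fun.intros)
  qed (rule vCons)
  also have "{x \<in> carrier_vec n. vCons 1 x \<in> {v \<in> carrier_vec (Suc n). \<forall>f\<in>S. f v = 0}} =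
      {x \<in> carrier_vec n. ?emb x \<in> proj_closure n Y}"
    using S(2) vCons by auto
  finally have "zariski_closed n {x \<in> carrier_vec n. ?emb x \<in> proj_closure n Y}" .
  moreover have "Y \<subseteq> {x \<in> carrier_vec n. ?emb x \<in> proj_closure n Y}"
    using Y hull_subset[of "?emb ` Y"] unfolding proj_closure_def by blast
  ultimately have "zariski_closure n Y \<subseteq> {x \<in> carrier_vec n. ?emb x \<in> proj_closure n Y}"
    unfolding zariski_closure_def by (rule hull_minimal[rotated])
  then have "?emb ` zariski_closure n Y \<subseteq> proj_closure n Y" by blast
  then show "proj_closure n (zariski_closure n Y) \<subseteq> proj_closure n Y"
    unfolding proj_closure_def[of n "zariski_closure n Y"] using closed by (rule hull_minimal)
qed

lemma mult_mat_vec_zero: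
  "N \<in> carrier_mat m n \<Longrightarrow> N *\<^sub>v 0\<^sub>v n = 0\<^sub>v m"
  by (auto intro!: eq_vecI)

text \<open>A point is a set of vectors, so taking the image of that set lets \<open>N\<close> act
  on points without a choice of representatives. The map \<rho> of the theorem is of this
  kind.\<close>

lemma proj_image_mat:
  fixes N :: "'a::field mat"
  assumes "N \<in> carrier_mat m m" "v \<in> carrier_vec m"
  shows "(*\<^sub>v) N ` proj_point v = proj_point (N *\<^sub>v v)"
proof -
  have "proj_point w = (\<lambda>c. c \<cdot>\<^sub>v w) ` {c. c \<noteq> 0}" for w :: "'a vec"
    by (auto simp: proj_point_def)
  then show ?thesis by (simp add: image_image mult_mat_vec[OF assms])
qed

text \<open>An invertible matrix sends no nonzero vector to zero and so permutes the points. Its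
  coordinates are linear forms, so substituting them into a form keeps the degree and preimages of
  closed sets are closed.\<close>

lemma proj_image_hull:
  fixes N N' :: "'a::field mat"
  assumes carrier: "N \<in> carrier_mat (Suc n) (Suc n)" "N' \<in> carrier_mat (Suc n) (Suc n)"
    and inv: "N * N' = 1\<^sub>m (Suc n)" "N' * N = 1\<^sub>m (Suc n)"
    and Y: "Y \<subseteq> proj_space n"
  shows "(`) ((*\<^sub>v) N) ` (proj_zariski_closed n hull Y) = proj_zariski_closed n hull ((`) ((*\<^sub>v) N) ` Y)"
proof -
  have inv_vec: "C *\<^sub>v (C' *\<^sub>v v) = v" if "C * C' = 1\<^sub>m (Suc n)" "C \<in> carrier_mat (Suc n) (Suc n)"
    "C' \<in> carrier_mat (Suc n) (Suc n)" "v \<in> carrier_vec (Suc n)" for C C' :: "'a mat" and v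
    using that by (simp flip: assoc_mult_mat_vec)
  have nonzero: "C *\<^sub>v v \<noteq> 0\<^sub>v (Suc n)" if "C' * C = 1\<^sub>m (Suc n)" "C \<in> carrier_mat (Suc n) (Suc n)"
    "C' \<in> carrier_mat (Suc n) (Suc n)" "v \<in> carrier_vec (Suc n)" "v \<noteq> 0\<^sub>v (Suc n)" for C C' :: "'a mat" and v
  proof
    assume "C *\<^sub>v v = 0\<^sub>v (Suc n)"
    then have "C' *\<^sub>v (C *\<^sub>v v) = 0\<^sub>v (Suc n)" using that by (simp add: mult_mat_vec_zero)
    then show False using inv_vec[of C' C v] that by simp
  qed
  have bij: "(*\<^sub>v) C ` P \<in> proj_space n \<and> (*\<^sub>v) C' ` ((*\<^sub>v) C ` P) = P"
    if C: "C' * C = 1\<^sub>m (Suc n)" "C \<in> carrier_mat (Suc n) (Suc n)"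
      "C' \<in> carrier_mat (Suc n) (Suc n)" and P: "P \<in> proj_space n" for C C' :: "'a mat" and P
  proof -
    obtain v where v: "P = proj_point v" "v \<in> carrier_vec (Suc n)" "v \<noteq> 0\<^sub>v (Suc n)"
      using P unfolding proj_space_def by blast
    then show ?thesis
      using C nonzero[OF C v(2,3)] inv_vec[of C' C v]
      by (simp add: proj_image_mat proj_point_in_proj_space)
  qed
  have cont: "proj_zariski_closed n {P \<in> proj_space n. (*\<^sub>v) C ` P \<in> Z}"
    if C: "C' * C = 1\<^sub>m (Suc n)" "C \<in> carrier_mat (Suc n) (Suc n)"
      "C' \<in> carrier_mat (Suc n) (Suc n)" and Z: "proj_zariski_closed n Z" for C C' :: "'a mat" and Z
  proof -
    obtain S where S_all: "\<forall>f\<in>S. \<exists>d. hom_poly_fun (Suc n) d f"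
    "\<forall>v\<in>carrier_vec (Suc n). v \<noteq> 0\<^sub>v (Suc n) \<longrightarrow> (proj_point v \<in> Z \<longleftrightarrow> (\<forall>f\<in>S. f v = 0))"
    using proj_zariski_closedD[OF Z] by blast
  note S = S_all[rule_format]
    have lin: "\<exists>g. hom_poly_fun (Suc n) 1 g \<and> (\<forall>v\<in>carrier_vec (Suc n). g v = (C *\<^sub>v v) $ i)"
      if "i < Suc n" for i
      by (intro exI[of _ "\<lambda>v. \<Sum>j<Suc n. C $$ (i, j) * v $ j"] conjI hom_poly_fun_linear)
         (use C that in \<open>auto simp: mat_mult_vec_index simp del: index_mult_mat_vec sum.lessThan_Suc\<close>)
    have "\<exists>g. (\<exists>d. hom_poly_fun (Suc n) d g) \<and> (\<forall>v\<in>carrier_vec (Suc n). g v = f (C *\<^sub>v v))" if "f \<in> S" for f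
      using hom_poly_fun_comp[OF _ lin] S(1)[OF that] by meson
    then obtain G where G: "\<And>f. f \<in> S \<Longrightarrow> (\<exists>d. hom_poly_fun (Suc n) d (G f)) \<and>
        (\<forall>v\<in>carrier_vec (Suc n). G f v = f (C *\<^sub>v v))"
      by metis
    show ?thesis
    proof (rule proj_zariski_closedI[of "G ` S"])
      fix v :: "'a vec" assume v: "v \<in> carrier_vec (Suc n)" "v \<noteq> 0\<^sub>v (Suc n)"
      have "proj_point v \<in> {P \<in> proj_space n. (*\<^sub>v) C ` P \<in> Z} \<longleftrightarrow> proj_point (C *\<^sub>v v) \<in> Z"
        using v C by (simp add: proj_image_mat proj_point_in_proj_space)
      also have "\<dots> \<longleftrightarrow> (\<forall>f\<in>S. f (C *\<^sub>v v) = 0)"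
        using C v nonzero[OF C v] by (intro S(2)) auto
      also have "\<dots> \<longleftrightarrow> (\<forall>f\<in>G ` S. f v = 0)" using G v by auto
      finally show "proj_point v \<in> {P \<in> proj_space n. (*\<^sub>v) C ` P \<in> Z} \<longleftrightarrow> (\<forall>f\<in>G ` S. f v = 0)" .
    qed (use G in auto)
  qed
  show ?thesis
  proof (rule image_hull_homeomorphism[where D="proj_space n" and g="(`) ((*\<^sub>v) N')"])
    show "proj_zariski_closed n {P \<in> proj_space n. (*\<^sub>v) N ` P \<in> Z}" if "proj_zariski_closed n Z" for Z
      using cont[OF inv(2) carrier that] .
    show "proj_zariski_closed n {P \<in> proj_space n. (*\<^sub>v) N' ` P \<in> Z}" if "proj_zariski_closed n Z" for Z
      using cont[OF inv(1) carrier(2,1) that] .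
    show "(*\<^sub>v) N ` P \<in> proj_space n \<and> (*\<^sub>v) N' ` (*\<^sub>v) N ` P = P" if "P \<in> proj_space n" for P
      using bij[OF inv(2) carrier that] .
    show "(*\<^sub>v) N' ` P \<in> proj_space n \<and> (*\<^sub>v) N ` (*\<^sub>v) N' ` P = P" if "P \<in> proj_space n" for P
      using bij[OF inv(1) carrier(2,1) that] .
  qed (use Y in \<open>auto simp: proj_zariski_closed_space proj_zariski_closed_subset proj_zariski_closed_Inter\<close>)
qed

section \<open>The rational normal curve\<close>

text \<open>Over a field, a zero determinant yields a nonzero kernel vector. The change of basis and
  \<open>rnc_mat\<close> are both inverted this way, without a formula for the inverse.\<close>

lemma trivial_kernel_inverse:
  fixes A :: "'a::field mat"
  assumes A: "A \<in> carrier_mat n n"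
    and ker: "\<And>v. v \<in> carrier_vec n \<Longrightarrow> A *\<^sub>v v = 0\<^sub>v n \<Longrightarrow> v = 0\<^sub>v n"
  obtains B where "B \<in> carrier_mat n n" "A * B = 1\<^sub>m n" "B * A = 1\<^sub>m n"
proof -
  have "det A \<noteq> 0" using ker det_0_iff_vec_prod_zero_field[OF A] by blast
  then have "A \<in> Units (ring_mat TYPE('a) n ())" by (rule det_non_zero_imp_unit[OF A])
  then show ?thesis using that by (auto simp: Units_def ring_mat_def)
qed

lemma invertible_matI:
  assumes "A \<in> carrier_mat n n" "B \<in> carrier_mat n n" "A * B = 1\<^sub>m n" "B * A = 1\<^sub>m n"
  shows "invertible_mat A"
  using assms unfolding invertible_mat_def inverts_mat_def square_mat.simps by auto

abbreviation rnc_vec :: "nat \<Rightarrow> nat \<Rightarrow> 'a::field \<Rightarrow> 'a \<Rightarrow> 'a vec" where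
  "rnc_vec n r t s \<equiv> vec (Suc n) (\<lambda>i. if i \<le> r then s ^ (r - i) * t ^ i else 0)"

lemma rnc_vec_nonzero:
  assumes "(t, s) \<noteq> (0, 0)" "r \<le> n"
  shows "rnc_vec n r t s \<noteq> 0\<^sub>v (Suc n)"
proof
  assume eq: "rnc_vec n r t s = 0\<^sub>v (Suc n)"
  have "rnc_vec n r t s $ 0 = s ^ r" "rnc_vec n r t s $ r = t ^ r" using assms(2) by auto
  then show False using assms eq by auto
qed

lemma rational_normal_curveI:
  "(t, s) \<noteq> (0, 0) \<Longrightarrow> proj_point (rnc_vec n r t s) \<in> rational_normal_curve n r"
  unfolding rational_normal_curve_def by blast

lemma rational_normal_curveE:
  assumes "P \<in> rational_normal_curve n r"
  obtains t s where "(t, s) \<noteq> (0, 0)" "P = proj_point (rnc_vec n r t s)"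
  using assms unfolding rational_normal_curve_def by blast

text \<open>The minors belong to the matrix with columns (v_i, v_(i+1)) for i < r. If v_0 is
  nonzero, they make the coordinates a geometric progression with ratio t = v_1 / v_0; otherwise
  only v_r can be nonzero.\<close>

lemma rational_normal_curve_minors:
  fixes v :: "'a::field vec"
  assumes r: "r \<le> n" and v: "v \<in> carrier_vec (Suc n)" "v \<noteq> 0\<^sub>v (Suc n)"
  shows "proj_point v \<in> rational_normal_curve n r \<longleftrightarrow>
    (\<forall>i<r. \<forall>j<r. v $ i * v $ Suc j = v $ Suc i * v $ j) \<and> (\<forall>i\<le>n. r < i \<longrightarrow> v $ i = 0)"
    (is "_ \<longleftrightarrow> ?minors \<and> ?zeros")
proof
  assume "proj_point v \<in> rational_normal_curve n r"
  then obtain t s where "proj_point v = proj_point (rnc_vec n r t s)"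
    by (rule rational_normal_curveE)
  then obtain c where c: "v = c \<cdot>\<^sub>v rnc_vec n r t s" using proj_point_iff[OF v(1)] by blast
  have v_eq: "v $ i = (if i \<le> r then c * (s ^ (r - i) * t ^ i) else 0)" if "i \<le> n" for i
    using c that by simp
  have "v $ i * v $ Suc j = v $ Suc i * v $ j" if "i < r" "j < r" for i j
  proof -
    \<comment> \<open>Both products contain the same power of s; splitting off one factor shows this
      despite truncated subtraction.\<close>
    have "r - i = Suc (r - Suc i)" "r - j = Suc (r - Suc j)" using that by auto
    then show ?thesis using r that by (simp add: v_eq)
  qed
  then show "?minors \<and> ?zeros" by (simp add: v_eq)
next
  assume *: "?minors \<and> ?zeros"
  show "proj_point v \<in> rational_normal_curve n r"
  proof (cases "v $ 0 = 0")
    case False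
    define t where "t = v $ 1 / v $ 0"
    have pow: "v $ i = v $ 0 * t ^ i" if "i \<le> r" for i
      using that
    proof (induction i)
      case (Suc i)
      \<comment> \<open>The minor of the columns 0 and i.\<close>
      then have "v $ 0 * v $ Suc i = v $ 1 * v $ i"
        using conjunct1[OF *, rule_format, of 0 i] by simp
      then show ?case using Suc False by (simp add: t_def field_simps)
    qed simp
    have "v = v $ 0 \<cdot>\<^sub>v rnc_vec n r t 1"
    proof (rule eq_vecI)
      fix i assume "i < dim_vec (v $ 0 \<cdot>\<^sub>v rnc_vec n r t 1)"
      then show "v $ i = (v $ 0 \<cdot>\<^sub>v rnc_vec n r t 1) $ i"
        using conjunct2[OF *] by (auto simp: pow[symmetric])
    qed (use v(1) in auto)
    then have "proj_point v = proj_point (rnc_vec n r t 1)"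
      using proj_point_iff[OF v(1)] False by blast
    then show ?thesis by (simp add: rational_normal_curveI)
  next
    case True
    have zero: "v $ i = 0" if "i < r" for i
      using that
    proof (induction i)
      case (Suc i)
      \<comment> \<open>Adjacent columns give a square, so zeros propagate up to index r - 1 and
        leave only the point (t : s) = (1 : 0).\<close>
      then have "v $ Suc i * v $ Suc i = v $ i * v $ Suc (Suc i)"
        using conjunct1[OF *, rule_format, of i "Suc i"] by simp
      then show ?case using Suc by simp
    qed (use True in simp)
    have other: "v $ i = 0" if "i \<le> n" "i \<noteq> r" for i
      using conjunct2[OF *] zero that by (cases i r rule: linorder_cases) auto
    have "v $ r \<noteq> 0"
    proof
      assume "v $ r = 0"
      then have "v $ i = 0" if "i \<le> n" for i
        using other[OF that] by (cases "i = r") auto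
      then have "v = 0\<^sub>v (Suc n)" using v(1) by (intro eq_vecI) (auto simp: less_Suc_eq_le)
      then show False using v(2) by blast
    qed
    moreover have "v = v $ r \<cdot>\<^sub>v rnc_vec n r 1 0"
    proof (rule eq_vecI)
      fix i assume "i < dim_vec (v $ r \<cdot>\<^sub>v rnc_vec n r 1 0)"
      then show "v $ i = (v $ r \<cdot>\<^sub>v rnc_vec n r 1 0) $ i"
        using other[of i] by (cases "i = r") (auto simp: power_0_left)
    qed (use v(1) in auto)
    ultimately have "proj_point v = proj_point (rnc_vec n r 1 0)"
      using proj_point_iff[OF v(1)] by blast
    then show ?thesis by (simp add: rational_normal_curveI)
  qed
qed

lemma proj_zariski_closed_rational_normal_curve:
  assumes r: "r \<le> n"
  shows "proj_zariski_closed n (rational_normal_curve n r :: 'a::field vec set set)"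
proof -
  define S :: "('a vec \<Rightarrow> 'a) set" where
    "S = (\<lambda>(i, j) v. v $ i * v $ Suc j - v $ Suc i * v $ j) ` ({..<r} \<times> {..<r}) \<union>
         (\<lambda>i v. v $ i) ` {r<..n}"
  show ?thesis
  proof (rule proj_zariski_closedI[of S])
    fix f assume "f \<in> S"
    then consider i j where "i < r" "j < r" "f = (\<lambda>v. v $ i * v $ Suc j - v $ Suc i * v $ j)"
      | i where "i \<le> n" "f = (\<lambda>v. v $ i)"
      by (auto simp: S_def)
    then show "\<exists>d. hom_poly_fun (Suc n) d f"
    proof cases
      case 1
      then have "hom_poly_fun (Suc n) (1 + 1) f"
        using r by (simp only:) (intro hom_poly_fun_diff hom_poly_fun.mult hom_poly_fun.coord; simp)
      then show ?thesis by blast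
    next
      case 2
      then show ?thesis using hom_poly_fun.coord[of i "Suc n"] by auto
    qed
  next
    show "rational_normal_curve n r \<subseteq> (proj_space n :: 'a vec set set)"
    proof
      fix P :: "'a vec set" assume "P \<in> rational_normal_curve n r"
      then show "P \<in> proj_space n"
        using rnc_vec_nonzero[OF _ r]
        by (auto elim!: rational_normal_curveE intro!: proj_point_in_proj_space)
    qed
  next
    fix v :: "'a vec" assume "v \<in> carrier_vec (Suc n)" "v \<noteq> 0\<^sub>v (Suc n)"
    then show "proj_point v \<in> rational_normal_curve n r \<longleftrightarrow> (\<forall>f\<in>S. f v = 0)"
      by (auto simp: rational_normal_curve_minors[OF r] S_def ball_Un)
  qed
qed

lemma poly_eq_0_cofinite:
  fixes p :: "'a::{idom,ring_char_0} poly"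
  assumes "finite T" "\<And>t. t \<notin> T \<Longrightarrow> poly p t = 0"
  shows "p = 0"
proof (rule ccontr)
  assume "p \<noteq> 0"
  then have "finite ({t. poly p t = 0} \<union> T)" using assms(1) poly_roots_finite by blast
  moreover have "{t. poly p t = 0} \<union> T = UNIV" using assms(2) by auto
  ultimately show False using infinite_UNIV_char_0[where 'a='a] by simp
qed

text \<open>\<open>T\<close> stands for the parameters lost to poles. Along the affine part of the
  curve a form is a polynomial in t, which finitely many exceptions cannot keep from being
  zero.\<close>

lemma proj_hull_rational_normal_curve:
  fixes T :: "'a::field_char_0 set"
  assumes T: "finite T" and r: "r \<le> n"
  shows "proj_zariski_closed n hull {proj_point (rnc_vec n r t 1) | t. t \<notin> T} = rational_normal_curve n r"
proof (rule hull_unique)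
  show "{proj_point (rnc_vec n r t 1) | t. t \<notin> T} \<subseteq> rational_normal_curve n r"
    using rational_normal_curveI[of _ 1] by auto
  show "proj_zariski_closed n (rational_normal_curve n r :: 'a vec set set)"
    using r by (rule proj_zariski_closed_rational_normal_curve)
next
  fix Z assume sub: "{proj_point (rnc_vec n r t 1) | t. t \<notin> T} \<subseteq> Z" and Z: "proj_zariski_closed n Z"
  obtain S where S_all: "\<forall>f\<in>S. \<exists>d. hom_poly_fun (Suc n) d f"
    "\<forall>v\<in>carrier_vec (Suc n). v \<noteq> 0\<^sub>v (Suc n) \<longrightarrow> (proj_point v \<in> Z \<longleftrightarrow> (\<forall>f\<in>S. f v = 0))"
    using proj_zariski_closedD[OF Z] by blast
  note S = S_all[rule_format]
  have vanish: "f (rnc_vec n r t s) = 0" if f: "f \<in> S" and ts: "(t, s) \<noteq> (0, 0)" for f t s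
  proof -
    obtain d where d: "hom_poly_fun (Suc n) d f" using S(1)[OF f] by blast
    note pf = hom_poly_fun_imp_poly_fun[OF d]
    have affine: "f (rnc_vec n r t 1) = 0" for t
    proof -
      have "\<exists>q. \<forall>t. f (rnc_vec n r t 1) = poly q t"
        by (rule poly_fun_along_poly_curve[OF pf, where p="\<lambda>i. if i \<le> r then Polynomial.monom 1 i else 0"])
           (auto simp: poly_monom)
      then obtain q where q: "\<And>t. f (rnc_vec n r t 1) = poly q t" by blast
      have "poly q t = 0" if "t \<notin> T" for t
      proof -
        have "proj_point (rnc_vec n r t 1) \<in> Z" using sub that by blast
        then show ?thesis
          using S(2)[of "rnc_vec n r t 1"] rnc_vec_nonzero[of t 1 r n] r f q by auto
      qed
      then have "q = 0" using poly_eq_0_cofinite[OF T] by blast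
      then show ?thesis using q by simp
    qed
    \<comment> \<open>By homogeneity, as (t : s) = (t/s : 1).\<close>
    have scaled: "f (rnc_vec n r t s) = 0" if "s \<noteq> 0" for t s
    proof -
      have "rnc_vec n r t s = s ^ r \<cdot>\<^sub>v rnc_vec n r (t / s) 1"
        using that by (intro eq_vecI) (auto simp: power_diff power_divide)
      then show ?thesis using affine[of "t / s"] by (simp add: hom_poly_fun_smult[OF d])
    qed
    show ?thesis
    proof (cases "s = 0")
      case True
      \<comment> \<open>Now t is fixed and s varies: a polynomial in s that vanishes at all nonzero
        s also vanishes at s = 0.\<close>
      have "\<exists>q. \<forall>s. f (rnc_vec n r t s) = poly q s"
        by (rule poly_fun_along_poly_curve[OF pf,
              where p="\<lambda>i. if i \<le> r then Polynomial.monom (t ^ i) (r - i) else 0"])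
           (auto simp: poly_monom mult.commute)
      then obtain q where q: "\<And>s. f (rnc_vec n r t s) = poly q s" by blast
      have "poly q s = 0" if "s \<noteq> 0" for s
        using scaled[OF that, of t] unfolding q .
      then have "q = 0" using poly_eq_0_cofinite[of "{0}" q] by simp
      then show ?thesis using q by simp
    qed (use scaled in simp)
  qed
  show "rational_normal_curve n r \<subseteq> Z"
  proof
    fix P :: "'a vec set" assume "P \<in> rational_normal_curve n r"
    then obtain t s where ts: "(t, s) \<noteq> (0, 0)" and P: "P = proj_point (rnc_vec n r t s)"
      by (rule rational_normal_curveE)
    show "P \<in> Z"
      unfolding P using S(2)[of "rnc_vec n r t s"] rnc_vec_nonzero[OF ts r] vanish[OF _ ts] by simp
  qed
qed

text \<open>In homogeneous coordinates \<open>(x\<^sub>0 : x)\<close>, the point \<open>y = A x + x\<^sub>0 b\<close> is sent to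
  \<open>(y\<^sub>0 : \<dots> : y\<^sub>r\<^sub>-\<^sub>1 : x\<^sub>0 - \<Sum>\<^sub>k m\<^sub>k y\<^sub>k : y\<^sub>r : \<dots> : y\<^sub>n\<^sub>-\<^sub>1)\<close>. For \<open>x\<^sub>0 = 1\<close> and \<open>y\<^sub>k = t\<^sup>k / M(t)\<close>,
  \<open>k < r\<close>, the coordinate \<open>r\<close> becomes \<open>t\<^sup>r / M(t)\<close>.\<close>

definition rnc_mat :: "nat \<Rightarrow> nat \<Rightarrow> 'a::field mat \<Rightarrow> 'a vec \<Rightarrow> (nat \<Rightarrow> 'a) \<Rightarrow> 'a mat" where
  "rnc_mat n r A b m = (let c = (\<lambda>k j. case j of 0 \<Rightarrow> b $ k | Suc l \<Rightarrow> A $$ (k, l)) in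
     mat (Suc n) (Suc n) (\<lambda>(i, j). if i < r then c i j
       else if i = r then (if j = 0 then 1 else 0) - (\<Sum>k<r. m k * c k j)
       else c (i - 1) j))"

lemma rnc_mat_carrier [simp]: "rnc_mat n r A b m \<in> carrier_mat (Suc n) (Suc n)"
  by (simp add: rnc_mat_def Let_def)

lemma rnc_mat_mult_vec:
  assumes A: "A \<in> carrier_mat n n" "b \<in> carrier_vec n" "x \<in> carrier_vec n" and r: "r \<le> n"
    and y: "y = A *\<^sub>v x + x0 \<cdot>\<^sub>v b"
  shows "rnc_mat n r A b m *\<^sub>v vCons x0 x =
    vec (Suc n) (\<lambda>i. if i < r then y $ i else if i = r then x0 - (\<Sum>k<r. m k * y $ k) else y $ (i - 1))"
    (is "?l = ?r")
proof (rule eq_vecI)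
  fix i assume "i < dim_vec ?r"
  then have i: "i < Suc n" by simp
  \<comment> \<open>The augmented matrix (b | A), whose product with (x0, x) is
    \<open>y\<close>.\<close>
  define c where "c = (\<lambda>k j. case j of 0 \<Rightarrow> b $ k | Suc l \<Rightarrow> A $$ (k, l))"
  have yc: "y $ k = (\<Sum>j<Suc n. c k j * vCons x0 x $ j)" if "k < n" for k
    using A that unfolding y
    by (simp add: mat_mult_vec_index sum.lessThan_Suc_shift c_def del: index_mult_mat_vec sum.lessThan_Suc)
  have l: "?l $ i = (\<Sum>j<Suc n. rnc_mat n r A b m $$ (i, j) * vCons x0 x $ j)"
    using A i by (intro mat_mult_vec_index[of _ "Suc n"]) auto
  have e: "rnc_mat n r A b m $$ (i, j) = (if i < r then c i j
       else if i = r then (if j = 0 then 1 else 0) - (\<Sum>k<r. m k * c k j)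
       else c (i - 1) j)" if "j < Suc n" for j
    using i that by (auto simp: rnc_mat_def Let_def c_def split: nat.split)
  consider "i < r" | "i = r" | "i > r" by linarith
  then show "?l $ i = ?r $ i"
  proof cases
    case 1
    then show ?thesis using r i by (simp add: l e yc del: sum.lessThan_Suc cong: sum.cong_simp)
  next
    case 2
    have "(\<Sum>j<Suc n. (if j = 0 then 1 else 0) * vCons x0 x $ j) = x0"
      by (simp add: sum.lessThan_Suc_shift del: sum.lessThan_Suc)
    moreover have "(\<Sum>j<Suc n. (\<Sum>k<r. m k * c k j) * vCons x0 x $ j) = (\<Sum>k<r. m k * y $ k)"
    proof -
      have "(\<Sum>j<Suc n. (\<Sum>k<r. m k * c k j) * vCons x0 x $ j)
          = (\<Sum>k<r. \<Sum>j<Suc n. m k * c k j * vCons x0 x $ j)"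
        unfolding sum_distrib_right by (rule sum.swap)
      also have "\<dots> = (\<Sum>k<r. m k * y $ k)"
        using r by (intro sum.cong refl) (simp add: yc sum_distrib_left mult.assoc del: sum.lessThan_Suc)
      finally show ?thesis .
    qed
    ultimately show ?thesis
      using 2 i by (simp add: l[unfolded 2] e[unfolded 2] left_diff_distrib sum_subtractf del: sum.lessThan_Suc cong: sum.cong_simp)
  next
    case 3
    then have "i - 1 < n" using i by simp
    then show ?thesis using 3 i by (simp add: l e yc del: sum.lessThan_Suc cong: sum.cong_simp)
  qed
qed (use A in \<open>simp add: rnc_mat_def Let_def\<close>)

text \<open>On a kernel vector, the coordinates other than r give y = 0; coordinate r then reduces
  to x0 = 0, so A x = 0 and finally x = 0.\<close>

lemma rnc_mat_inverse:
  fixes A :: "'a::field mat"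
  assumes A: "A \<in> carrier_mat n n" "b \<in> carrier_vec n" and r: "r \<le> n"
    and inv: "A' \<in> carrier_mat n n" "A' * A = 1\<^sub>m n"
  obtains N where "N \<in> carrier_mat (Suc n) (Suc n)"
    "rnc_mat n r A b m * N = 1\<^sub>m (Suc n)" "N * rnc_mat n r A b m = 1\<^sub>m (Suc n)"
proof (rule trivial_kernel_inverse[OF rnc_mat_carrier])
  fix v assume v: "v \<in> carrier_vec (Suc n)" "rnc_mat n r A b m *\<^sub>v v = 0\<^sub>v (Suc n)"
  obtain x0 x where x: "v = vCons x0 x" "x \<in> carrier_vec n"
    using v(1) by (cases v) auto
  define y where "y = A *\<^sub>v x + x0 \<cdot>\<^sub>v b"
  have eqs: "(if i < r then y $ i else if i = r then x0 - (\<Sum>k<r. m k * y $ k) else y $ (i - 1)) = 0"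
    if "i \<le> n" for i
    using that arg_cong[OF v(2), of "\<lambda>v. v $ i"] rnc_mat_mult_vec[OF A x(2) r y_def, of m] x
    by simp
  have y0: "y $ i = 0" if "i < n" for i
  proof (cases "i < r")
    case True
    then show ?thesis using eqs[of i] that by simp
  next
    case False
    \<comment> \<open>From index r on, y sits one place further, behind the inserted coordinate
      r.\<close>
    then show ?thesis using eqs[of "Suc i"] that by simp
  qed
  have "x0 = 0" using eqs[of r] r y0 by simp
  moreover have "y = 0\<^sub>v n" using y0 A x by (intro eq_vecI) (auto simp: y_def)
  moreover have "0 \<cdot>\<^sub>v b = 0\<^sub>v n" using A by (intro eq_vecI) auto
  ultimately have "A *\<^sub>v x = 0\<^sub>v n" using A x by (simp add: y_def)
  then have "A' *\<^sub>v (A *\<^sub>v x) = 0\<^sub>v n" using inv by (simp add: mult_mat_vec_zero)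
  then have "x = 0\<^sub>v n" using inv A x by (simp flip: assoc_mult_mat_vec)
  then show "v = 0\<^sub>v (Suc n)" using x \<open>x0 = 0\<close> by (simp add: zero_vec_Suc)
qed

section \<open>Hypercircles\<close>

lemma unit_partial_fraction:
  assumes M: "is_min_poly M (- d)"
  shows "Fract [:b, a:] [:d, 1:] = to_fract [:a:] +
    (\<Sum>i<Polynomial.degree M. to_fract [:(b - a * d) * quot_coeff M (- d) i:] *
       Fract (Polynomial.monom 1 i) (map_poly to_ac M))"
proof -
  define P where "P = map_poly to_ac M"
  define m where "m = (\<Sum>i<Polynomial.degree M. Polynomial.monom (quot_coeff M (- d) i) i)"
  define e where "e = b - a * d"
  have fac: "[:d, 1:] * m = P"
    using linear_factor_quot_coeff[of M "- d"] M by (simp add: m_def P_def is_min_poly_def)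
  have "P \<noteq> 0" using is_min_poly_nonzero[OF M] by (simp add: P_def)
  then have "m \<noteq> 0" using fac by auto
  have "[:e * quot_coeff M (- d) i:] * Polynomial.monom 1 i = [:e:] * Polynomial.monom (quot_coeff M (- d) i) i" for i
    by (simp add: smult_monom)
  then have "to_fract [:e * quot_coeff M (- d) i:] * Fract (Polynomial.monom 1 i) P =
      to_fract [:e:] * to_fract (Polynomial.monom (quot_coeff M (- d) i) i) / to_fract P" for i
    unfolding Fract_conv_to_fract times_divide_eq_right to_fract_mult[symmetric] by simp
  then have "(\<Sum>i<Polynomial.degree M. to_fract [:e * quot_coeff M (- d) i:] * Fract (Polynomial.monom 1 i) P)
      = to_fract [:e:] * to_fract m / to_fract P"
    by (simp only: m_def to_fract_sum sum_distrib_left sum_divide_distrib)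
  also have "\<dots> = to_fract [:e:] / to_fract [:d, 1:]"
    unfolding fac[symmetric] to_fract_mult using \<open>m \<noteq> 0\<close> by simp
  finally have sum: "(\<Sum>i<Polynomial.degree M. to_fract [:e * quot_coeff M (- d) i:] *
      Fract (Polynomial.monom 1 i) P) = to_fract [:e:] / to_fract [:d, 1:]" .
  have "[:b, a:] = [:a:] * [:d, 1:] + [:e:]" by (simp add: e_def)
  then have "Fract [:b, a:] [:d, 1:] = (to_fract [:a:] * to_fract [:d, 1:] + to_fract [:e:]) / to_fract [:d, 1:]"
    unfolding Fract_conv_to_fract by (simp only: to_fract_add to_fract_mult)
  also have "\<dots> = to_fract [:a:] + to_fract [:e:] / to_fract [:d, 1:]"
    by (simp add: add_divide_distrib del: to_fract_mult)
  finally show ?thesis using sum by (simp only: e_def P_def)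
qed

section \<open>Constants of K inside F(t), and the target curve\<close>

abbreviation fconst :: "'k::field \<Rightarrow> 'k alg_closure poly fract" where
  "fconst c \<equiv> to_fract [:to_ac c:]"

lemma to_fract_const_sum:
  "to_fract [:\<Sum>j\<in>J. g j * h j:] = (\<Sum>j\<in>J. to_fract [:g j:] * to_fract [:h j:])"
proof -
  have "[:\<Sum>j\<in>J. g j * h j:] = (\<Sum>j\<in>J. [:g j:] * [:h j:])"
    by (rule poly_eqI) (simp add: Polynomial.coeff_sum coeff_pCons mult.commute split: nat.split)
  then show ?thesis by (simp only: to_fract_sum to_fract_mult)
qed

lemma fconst_sum: "fconst (\<Sum>j\<in>J. g j * h j) = (\<Sum>j\<in>J. fconst (g j) * fconst (h j))"
  by (simp only: to_ac_sum to_ac_mult to_fract_const_sum)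

lemma fconst_uminus: "fconst (- x) = - fconst x"
  by (simp flip: to_fract_uminus)

text \<open>The coordinates required in item 1, with r read as the degree of \<open>M\<close>. The
  trailing zeros belong to the basis elements that are added to the r given ones.\<close>

definition monomial_curve :: "'k::field poly \<Rightarrow> nat \<Rightarrow> 'k alg_closure poly fract" where
  "monomial_curve M i = (if i < Polynomial.degree M
     then Fract (Polynomial.monom 1 i) (map_poly to_ac M) else 0)"

lemma monomial_curve_in_base: "M \<noteq> 0 \<Longrightarrow> monomial_curve M i \<in> ratfuns_over_base"
  by (auto simp: monomial_curve_def intro!: ratfuns_over_baseI[of M _ "Polynomial.monom 1 i"])

text \<open>Coordinate 0 decides: if 1/M = p/q then q = p M, so no representation removes a root of
  M from the denominator.\<close>

lemma ratfun_defined_monomial_curve: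
  assumes "0 < Polynomial.degree M" "Polynomial.degree M \<le> n"
  shows "(\<forall>i<n. ratfun_defined (monomial_curve M i) t) \<longleftrightarrow> aeval M t \<noteq> 0"
proof
  assume "\<forall>i<n. ratfun_defined (monomial_curve M i) t"
  then have "ratfun_defined (Fract 1 (map_poly to_ac M)) t"
    using assms by (force simp: monomial_curve_def)
  then obtain p q where pq: "Fract 1 (map_poly to_ac M) = Fract p q" "poly q t \<noteq> 0"
    using ratfun_defined_eval_iff by metis
  have "M \<noteq> 0" "q \<noteq> 0" using assms pq(2) by auto
  then have "q = p * map_poly to_ac M" using pq(1) by (simp add: eq_fract)
  then show "aeval M t \<noteq> 0" using pq(2) by auto
qed (simp add: monomial_curve_def ratfun_Fract)

lemma ratfun_eval_monomial_curve:
  assumes "aeval M t \<noteq> 0"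
  shows "ratfun_eval (monomial_curve M i) t = (if i < Polynomial.degree M then t ^ i / aeval M t else 0)"
  using assms by (simp add: monomial_curve_def ratfun_Fract poly_monom)

text \<open>Column i of \<open>B\<close> lists the coordinates of a basis element \<open>w i\<close>
  in the powers of \<alpha>, and \<open>c\<close> lists those of \<open>a\<close>. Collecting the
  terms of u at each power of \<alpha> gives elements of K(t), which uniqueness identifies as the
  components.\<close>

lemma hypercircle_components:
  fixes \<alpha> a b d :: "'k::field alg_closure" and M :: "'k poly"
  defines "n \<equiv> ext_degree (adjoin \<alpha>)" and "u \<equiv> Fract [:b, a:] [:d, 1:]"
  assumes coeffs: "a \<in> adjoin \<alpha>" "b \<in> adjoin \<alpha>" "d \<in> adjoin \<alpha>"
    and unit: "a * d - b \<noteq> 0" and M: "is_min_poly M (- d)"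
  obtains A B :: "'k mat" and c :: "'k vec" where
    "A \<in> carrier_mat n n" "B \<in> carrier_mat n n" "A * B = 1\<^sub>m n" "B * A = 1\<^sub>m n"
    "c \<in> carrier_vec n" "Polynomial.degree M \<le> n"
    "\<And>j. j < n \<Longrightarrow> alpha_components \<alpha> u j =
       fconst (c $ j) + (\<Sum>i<n. fconst (B $$ (j, i)) * monomial_curve M i)"
proof -
  define e where "e = b - a * d"
  have e: "e \<noteq> 0" "e \<in> adjoin \<alpha>"
    using unit coeffs by (auto simp: e_def intro: adjoin_diff adjoin_mult)
  obtain M\<alpha> where M\<alpha>: "is_min_poly M\<alpha> \<alpha>" using is_min_poly_exists by blast
  have n: "n = Polynomial.degree M\<alpha>" unfolding n_def by (rule ext_degree_adjoin[OF M\<alpha>])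
  have ind: "lin_indep n (\<lambda>i. \<alpha> ^ i)" unfolding n by (rule lin_indep_powers[OF M\<alpha>])
  have coords: "\<exists>c. y = (\<Sum>j<n. to_ac (c j) * \<alpha> ^ j)" if "y \<in> adjoin \<alpha>" for y
    using adjoin_power_basis[OF M\<alpha> that] unfolding n by blast
  define w0 where "w0 i = e * quot_coeff M (- d) i" for i
  have w0: "lin_indep (Polynomial.degree M) w0"
    unfolding lin_indep_def
  proof (intro allI impI)
    fix c :: "nat \<Rightarrow> 'k" and i
    assume "(\<Sum>i<Polynomial.degree M. to_ac (c i) * w0 i) = 0" and i: "i < Polynomial.degree M"
    then have "e * (\<Sum>i<Polynomial.degree M. to_ac (c i) * quot_coeff M (- d) i) = 0"
      by (simp add: w0_def sum_distrib_left mult.left_commute)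
    then have "(\<Sum>i<Polynomial.degree M. to_ac (c i) * quot_coeff M (- d) i) = 0" using e(1) by simp
    then show "c i = 0" using lin_indep_quot_coeff[OF M] i by (auto simp: lin_indep_def)
  qed
  have w0_in: "w0 i \<in> adjoin \<alpha>" for i
    using e(2) adjoin_uminus[OF coeffs(3)] by (simp add: w0_def adjoin_mult quot_coeff_in_adjoin)
  have rn: "Polynomial.degree M \<le> n"
    unfolding n_def using w0 w0_in by (rule lin_indep_extend(1))
  \<comment> \<open>Only the first r basis elements are prescribed; any completion serves, since
    \<open>monomial_curve\<close> is zero at the later indices.\<close>
  obtain w where w: "lin_indep n w" "\<forall>i<Polynomial.degree M. w i = w0 i" "\<forall>i<n. w i \<in> adjoin \<alpha>"
    using lin_indep_extend(2)[OF w0 w0_in] unfolding n_def by blast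
  have "\<forall>i\<in>{..<n}. \<exists>c. w i = (\<Sum>j<n. to_ac (c j) * \<alpha> ^ j)" using w(3) coords by blast
  from bchoice[OF this] obtain C where
    C: "\<forall>i\<in>{..<n}. w i = (\<Sum>j<n. to_ac (C i j) * \<alpha> ^ j)" ..
  obtain c where c: "a = (\<Sum>j<n. to_ac (c j) * \<alpha> ^ j)" using coords[OF coeffs(1)] by blast
  define B where "B = mat n n (\<lambda>(j, i). C i j)"
  have B: "B \<in> carrier_mat n n" by (simp add: B_def)
  have w_B: "w i = (\<Sum>j<n. to_ac (B $$ (j, i)) * \<alpha> ^ j)" if "i < n" for i
    using C that by (simp add: B_def cong: sum.cong_simp)
  obtain A where A: "A \<in> carrier_mat n n" "B * A = 1\<^sub>m n" "A * B = 1\<^sub>m n"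
  proof (rule trivial_kernel_inverse[OF B])
    \<comment> \<open>A kernel vector of \<open>B\<close> is the coefficient vector of a K-relation
      between the \<open>w i\<close>.\<close>
    fix v assume v: "v \<in> carrier_vec n" "B *\<^sub>v v = 0\<^sub>v n"
    have Bv: "(\<Sum>i<n. B $$ (j, i) * v $ i) = 0" if "j < n" for j
      using mat_mult_vec_index[OF B v(1) that] v(2) that by simp
    have "(\<Sum>i<n. to_ac (v $ i) * w i) = (\<Sum>i<n. \<Sum>j<n. to_ac (B $$ (j, i) * v $ i) * \<alpha> ^ j)"
      by (intro sum.cong refl) (simp add: w_B sum_distrib_left mult_ac)
    also have "\<dots> = (\<Sum>j<n. to_ac (\<Sum>i<n. B $$ (j, i) * v $ i) * \<alpha> ^ j)"
      unfolding to_ac_sum sum_distrib_right by (rule sum.swap)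
    also have "\<dots> = 0" by (simp add: Bv)
    finally have "\<forall>i<n. v $ i = 0"
      using w(1) unfolding lin_indep_def by (elim allE[of _ "\<lambda>i. v $ i"]) simp
    then show "v = 0\<^sub>v n" using v(1) by (intro eq_vecI) auto
  qed
  define \<phi> where "\<phi> j = (if j < n then
      fconst (c j) + (\<Sum>i<n. fconst (B $$ (j, i)) * monomial_curve M i) else 0)" for j
  have "alpha_components \<alpha> u = \<phi>"
  proof (rule alpha_components_eqI)
    show "\<phi> i \<in> ratfuns_over_base" if "i < ext_degree (adjoin \<alpha>)" for i
      unfolding \<phi>_def using is_min_poly_nonzero[OF M]
      by (auto intro!: ratfuns_over_base_add ratfuns_over_base_sum ratfuns_over_base_mult
          monomial_curve_in_base)
    have "u = to_fract [:a:] + (\<Sum>i<Polynomial.degree M. to_fract [:w0 i:] *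
        Fract (Polynomial.monom 1 i) (map_poly to_ac M))"
      unfolding u_def w0_def e_def by (rule unit_partial_fraction[OF M])
    also have "(\<Sum>i<Polynomial.degree M. to_fract [:w0 i:] *
        Fract (Polynomial.monom 1 i) (map_poly to_ac M)) = (\<Sum>i<n. to_fract [:w i:] * monomial_curve M i)"
      by (rule sum.mono_neutral_cong_left) (use rn w(2) in \<open>auto simp: monomial_curve_def\<close>)
    also have "to_fract [:a:] = (\<Sum>j<n. fconst (c j) * to_fract [:\<alpha> ^ j:])"
      unfolding c by (rule to_fract_const_sum)
    also have "(\<Sum>i<n. to_fract [:w i:] * monomial_curve M i) =
        (\<Sum>i<n. \<Sum>j<n. fconst (B $$ (j, i)) * to_fract [:\<alpha> ^ j:] * monomial_curve M i)"
      by (intro sum.cong refl) (simp add: w_B to_fract_const_sum sum_distrib_right)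
    also have "\<dots> = (\<Sum>j<n. \<Sum>i<n. fconst (B $$ (j, i)) * to_fract [:\<alpha> ^ j:] * monomial_curve M i)"
      by (rule sum.swap)
    also have "(\<Sum>j<n. fconst (c j) * to_fract [:\<alpha> ^ j:]) + \<dots> = (\<Sum>j<n. \<phi> j * to_fract [:\<alpha> ^ j:])"
      unfolding sum.distrib[symmetric] \<phi>_def
      by (intro sum.cong refl) (simp add: algebra_simps sum_distrib_left)
    finally show "u = (\<Sum>j<ext_degree (adjoin \<alpha>). \<phi> j * to_fract [:\<alpha> ^ j:])"
      unfolding n_def .
  qed (use ind in \<open>auto simp: n_def \<phi>_def\<close>)
  then show ?thesis
    using that[of A B "vec n c"] A B rn by (simp add: \<phi>_def)
qed

text \<open>The two relations force f and g to have the same domain, so the parametrized sets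
  correspond exactly and not only up to closure. The projective part uses this pointwise
  form.\<close>

lemma rational_curve_affine_image:
  fixes n :: nat and A B :: "'k::field alg_closure mat" and a b :: "'k alg_closure vec"
  defines "param \<equiv> \<lambda>f. {vec n (\<lambda>i. ratfun_eval (f i) t) | t. \<forall>i<n. ratfun_defined (f i) t}"
  assumes carrier: "A \<in> carrier_mat n n" "B \<in> carrier_mat n n" "a \<in> carrier_vec n" "b \<in> carrier_vec n"
    and inv: "\<And>x. x \<in> carrier_vec n \<Longrightarrow> B *\<^sub>v (A *\<^sub>v x + a) + b = x"
      "\<And>x. x \<in> carrier_vec n \<Longrightarrow> A *\<^sub>v (B *\<^sub>v x + b) + a = x"
    and f: "\<And>i. i < n \<Longrightarrow> f i = to_fract [:a $ i:] + (\<Sum>j<n. to_fract [:A $$ (i, j):] * g j)"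
    and g: "\<And>i. i < n \<Longrightarrow> g i = to_fract [:b $ i:] + (\<Sum>j<n. to_fract [:B $$ (i, j):] * f j)"
  shows "(\<lambda>x. A *\<^sub>v x + a) ` param g = param f"
    and "(\<lambda>x. A *\<^sub>v x + a) ` rational_curve n g = rational_curve n f"
proof -
  let ?\<chi> = "\<lambda>x. A *\<^sub>v x + a"
  note fwd = ratfun_eval_affine[OF carrier(1,3) f] and bwd = ratfun_eval_affine[OF carrier(2,4) g]
  show image: "?\<chi> ` param g = param f"
  proof (intro equalityI subsetI)
    fix y assume "y \<in> ?\<chi> ` param g"
    then obtain t where t: "\<forall>i<n. ratfun_defined (g i) t" "y = ?\<chi> (vec n (\<lambda>i. ratfun_eval (g i) t))"
      by (auto simp: param_def)
    then have "y = vec n (\<lambda>i. ratfun_eval (f i) t)" "\<forall>i<n. ratfun_defined (f i) t"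
      using fwd[of t] by simp_all
    then show "y \<in> param f" unfolding param_def by blast
  next
    fix y assume "y \<in> param f"
    then obtain t where t: "\<forall>i<n. ratfun_defined (f i) t" "y = vec n (\<lambda>i. ratfun_eval (f i) t)"
      by (auto simp: param_def)
    then have g_def: "\<forall>i<n. ratfun_defined (g i) t" using bwd(1)[of t] by simp
    then have "y = ?\<chi> (vec n (\<lambda>i. ratfun_eval (g i) t))" using t(2) fwd(2)[of t] by simp
    then show "y \<in> ?\<chi> ` param g" unfolding param_def using g_def by blast
  qed
  have "?\<chi> ` zariski_closure n (param g) = zariski_closure n (?\<chi> ` param g)"
    by (rule affine_image_zariski_closure[OF carrier inv]) (auto simp: param_def)
  then show "?\<chi> ` rational_curve n g = rational_curve n f"
    unfolding image by (simp add: rational_curve_def param_def)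
qed

text \<open>The entries arise by ring operations, which the embedding respects. So the projective
  matrix can be formed over K and evaluated over F.\<close>

lemma map_mat_rnc_mat:
  assumes "A \<in> carrier_mat n n" "b \<in> carrier_vec n" "r \<le> n"
  shows "map_mat to_ac (rnc_mat n r A b m) = rnc_mat n r (map_mat to_ac A) (map_vec to_ac b) (to_ac \<circ> m)"
  using assms
  by (intro eq_matI) (auto simp: rnc_mat_def Let_def to_ac_sum split: nat.splits intro!: sum.cong)

theorem theorem3p1:
  fixes \<alpha> a b d :: "'k::field_char_0 alg_closure"
    and M :: "'k poly" and n r :: nat and U :: "'k alg_closure vec set"
  assumes n: "n = ext_degree (adjoin \<alpha>)"
    and coeffs: "a \<in> adjoin \<alpha>" "b \<in> adjoin \<alpha>" "d \<in> adjoin \<alpha>"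
    and unit: "a * d - b \<noteq> 0"
    and U: "U = hypercircle \<alpha> (Fract [:b, a:] [:d, 1:])"
    and r: "r = ext_degree (adjoin (- d))"
    and M: "is_min_poly M (- d)"
  shows "(\<exists>\<chi>. affine_transformation_over_base n \<chi> \<and>
            \<chi> ` U = rational_curve n
              (\<lambda>i. if i < r then Fract (Polynomial.monom 1 i) (map_poly to_ac M) else 0)) \<and>
         (\<exists>\<rho>. proj_transformation_over_base n \<rho> \<and>
            \<rho> ` proj_closure n U = rational_normal_curve n r)"
proof -
  have r_deg: "r = Polynomial.degree M" unfolding r by (rule ext_degree_adjoin[OF M])
  have r_pos: "0 < r" unfolding r_deg by (rule is_min_poly_degree_pos[OF M])
  define \<phi> where "\<phi> = alpha_components \<alpha> (Fract [:b, a:] [:d, 1:])"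
  have curve_eq: "(\<lambda>i. if i < r then Fract (Polynomial.monom 1 i) (map_poly to_ac M) else 0) = monomial_curve M"
    by (simp add: monomial_curve_def r_deg fun_eq_iff)
  have U_eq: "U = rational_curve n \<phi>" by (simp add: U hypercircle_def n \<phi>_def)
  obtain A B :: "'k mat" and c :: "'k vec" where AB:
    "A \<in> carrier_mat n n" "B \<in> carrier_mat n n" "A * B = 1\<^sub>m n" "B * A = 1\<^sub>m n"
    "c \<in> carrier_vec n" and rn: "r \<le> n"
    and \<phi>_eq: "\<And>j. j < n \<Longrightarrow> \<phi> j = fconst (c $ j) + (\<Sum>i<n. fconst (B $$ (j, i)) * monomial_curve M i)"
    using hypercircle_components[OF coeffs unit M] unfolding n \<phi>_def r_deg by blast
  \<comment> \<open>Solving \<open>\<phi>\<close> = c + B \<mu> for the monomial curve \<mu> gives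
    \<mu> = A \<open>\<phi>\<close> - A c.\<close>
  define b' where "b' = - (A *\<^sub>v c)"
  have b': "b' \<in> carrier_vec n" using AB by (simp add: b'_def)
  define A\<^sub>F where "A\<^sub>F = map_mat to_ac A"
  define B\<^sub>F where "B\<^sub>F = map_mat to_ac B"
  define b\<^sub>F where "b\<^sub>F = map_vec to_ac b'"
  define c\<^sub>F where "c\<^sub>F = map_vec to_ac c"
  have carrier: "A\<^sub>F \<in> carrier_mat n n" "B\<^sub>F \<in> carrier_mat n n" "b\<^sub>F \<in> carrier_vec n" "c\<^sub>F \<in> carrier_vec n"
    using AB b' by (simp_all add: A\<^sub>F_def B\<^sub>F_def b\<^sub>F_def c\<^sub>F_def)
  have inv_F: "A\<^sub>F * B\<^sub>F = 1\<^sub>m n" "B\<^sub>F * A\<^sub>F = 1\<^sub>m n"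
    unfolding A\<^sub>F_def B\<^sub>F_def using to_ac_hom.mat_hom_mult AB to_ac_hom.mat_hom_one by metis+
  have b_F: "b\<^sub>F = - (A\<^sub>F *\<^sub>v c\<^sub>F)"
  proof -
    have "b\<^sub>F = - map_vec to_ac (A *\<^sub>v c)"
      unfolding b\<^sub>F_def b'_def by (intro eq_vecI) auto
    then show ?thesis
      using to_ac_hom.mult_mat_vec_hom[OF AB(1,5)] by (simp add: A\<^sub>F_def c\<^sub>F_def)
  qed
  have inv: "B\<^sub>F *\<^sub>v (A\<^sub>F *\<^sub>v x + b\<^sub>F) + c\<^sub>F = x" "A\<^sub>F *\<^sub>v (B\<^sub>F *\<^sub>v x + c\<^sub>F) + b\<^sub>F = x"
    if x: "x \<in> carrier_vec n" for x
  proof -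
    have "B\<^sub>F *\<^sub>v b\<^sub>F = - c\<^sub>F"
    proof -
      have "B\<^sub>F *\<^sub>v b\<^sub>F = - (B\<^sub>F *\<^sub>v (A\<^sub>F *\<^sub>v c\<^sub>F))"
        unfolding b_F using carrier
        by (intro eq_vecI) (auto intro!: scalar_prod_uminus_right simp del: assoc_mult_mat_vec)
      then show ?thesis using carrier inv_F(2) by (simp flip: assoc_mult_mat_vec)
    qed
    moreover have "B\<^sub>F *\<^sub>v (A\<^sub>F *\<^sub>v x) = x" "A\<^sub>F *\<^sub>v (B\<^sub>F *\<^sub>v x) = x"
      using x carrier inv_F by (simp_all flip: assoc_mult_mat_vec)
    moreover have cancel: "A\<^sub>F *\<^sub>v c\<^sub>F + - (A\<^sub>F *\<^sub>v c\<^sub>F) = 0\<^sub>v n"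
      using carrier by (intro uminus_r_inv_vec mult_mat_vec_carrier)
    ultimately show "B\<^sub>F *\<^sub>v (A\<^sub>F *\<^sub>v x + b\<^sub>F) + c\<^sub>F = x" "A\<^sub>F *\<^sub>v (B\<^sub>F *\<^sub>v x + c\<^sub>F) + b\<^sub>F = x"
      using x carrier by (simp_all add: mult_add_distrib_mat_vec[of _ n n] b_F cancel)
  qed
  \<comment> \<open>The same inversion for rational functions: A B = 1 collapses the double sum to
    the single term k = i.\<close>
  have fwd: "monomial_curve M i = to_fract [:b\<^sub>F $ i:] + (\<Sum>j<n. to_fract [:A\<^sub>F $$ (i, j):] * \<phi> j)"
    if i: "i < n" for i
  proof -
    have AB_ik: "(\<Sum>j<n. A $$ (i, j) * B $$ (j, k)) = (if i = k then 1 else 0)" if "k < n" for k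
      using arg_cong[OF AB(3), of "\<lambda>M. M $$ (i, k)"] AB(1,2) i that
      by (simp add: scalar_prod_def atLeast0LessThan)
    have "(\<Sum>j<n. fconst (A $$ (i, j)) * \<phi> j) = (\<Sum>j<n. fconst (A $$ (i, j)) * fconst (c $ j)) +
        (\<Sum>j<n. \<Sum>k<n. fconst (A $$ (i, j)) * fconst (B $$ (j, k)) * monomial_curve M k)"
      unfolding sum.distrib[symmetric]
      by (intro sum.cong refl) (simp add: \<phi>_eq distrib_left sum_distrib_left mult.assoc)
    also have "(\<Sum>j<n. \<Sum>k<n. fconst (A $$ (i, j)) * fconst (B $$ (j, k)) * monomial_curve M k) =
        (\<Sum>k<n. fconst (\<Sum>j<n. A $$ (i, j) * B $$ (j, k)) * monomial_curve M k)"
      unfolding fconst_sum sum_distrib_right by (rule sum.swap)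
    also have "\<dots> = (\<Sum>k<n. if i = k then monomial_curve M k else 0)"
      by (intro sum.cong refl) (simp add: AB_ik one_pCons[symmetric])
    also have "\<dots> = monomial_curve M i" using i by simp
    also have "(\<Sum>j<n. fconst (A $$ (i, j)) * fconst (c $ j)) = - to_fract [:b\<^sub>F $ i:]"
    proof -
      have "b' $ i = - (\<Sum>j<n. A $$ (i, j) * c $ j)"
        using AB i by (simp add: b'_def mat_mult_vec_index[of A n n] del: index_mult_mat_vec)
      then show ?thesis using i b' by (simp add: b\<^sub>F_def fconst_uminus fconst_sum del: to_ac_minus)
    qed
    finally show ?thesis using i AB by (simp add: A\<^sub>F_def)
  qed
  have bwd: "\<phi> j = to_fract [:c\<^sub>F $ j:] + (\<Sum>i<n. to_fract [:B\<^sub>F $$ (j, i):] * monomial_curve M i)"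
    if "j < n" for j
    using that AB by (simp add: \<phi>_eq c\<^sub>F_def B\<^sub>F_def)
  note image = rational_curve_affine_image[OF carrier inv fwd bwd]
  have "\<exists>\<chi>. affine_transformation_over_base n \<chi> \<and> \<chi> ` U = rational_curve n (monomial_curve M)"
  proof (intro exI conjI)
    show "affine_transformation_over_base n (\<lambda>x. A\<^sub>F *\<^sub>v x + b\<^sub>F)"
      unfolding affine_transformation_over_base_def A\<^sub>F_def b\<^sub>F_def
      using AB b' invertible_matI[OF AB(1-4)] by blast
    show "(\<lambda>x. A\<^sub>F *\<^sub>v x + b\<^sub>F) ` U = rational_curve n (monomial_curve M)"
      unfolding U_eq by (rule image(2))
  qed
  moreover have "\<exists>\<rho>. proj_transformation_over_base n \<rho> \<and>
      \<rho> ` proj_closure n U = rational_normal_curve n r"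
  proof (intro exI conjI)
    define N where "N = rnc_mat n r A b' (poly.coeff M)"
    define N\<^sub>F where "N\<^sub>F = map_mat to_ac N"
    obtain N' where N': "N' \<in> carrier_mat (Suc n) (Suc n)" "N * N' = 1\<^sub>m (Suc n)" "N' * N = 1\<^sub>m (Suc n)"
      unfolding N_def using rnc_mat_inverse[OF AB(1) b' rn AB(2,4)] by blast
    have N: "N \<in> carrier_mat (Suc n) (Suc n)" by (simp add: N_def)
    have N_F: "N\<^sub>F \<in> carrier_mat (Suc n) (Suc n)" "map_mat to_ac N' \<in> carrier_mat (Suc n) (Suc n)"
      "N\<^sub>F * map_mat to_ac N' = 1\<^sub>m (Suc n)" "map_mat to_ac N' * N\<^sub>F = 1\<^sub>m (Suc n)"
      unfolding N\<^sub>F_def using N N' to_ac_hom.mat_hom_mult to_ac_hom.mat_hom_one by (simp, simp, metis+)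
    show "proj_transformation_over_base n ((`) ((*\<^sub>v) N\<^sub>F))"
      unfolding proj_transformation_over_base_def
      using N invertible_matI[OF N N'] proj_image_mat[OF N_F(1)] unfolding N\<^sub>F_def by blast
    \<comment> \<open>The parametrized points before any closure; the computation with coordinates
      takes place on them.\<close>
    define \<P> where "\<P> = {vec n (\<lambda>i. ratfun_eval (\<phi> i) t) | t. \<forall>i<n. ratfun_defined (\<phi> i) t}"
    have \<P>: "\<P> \<subseteq> carrier_vec n" by (auto simp: \<P>_def)
    let ?\<chi> = "\<lambda>x. A\<^sub>F *\<^sub>v x + b\<^sub>F"
    have \<chi>_\<P>: "?\<chi> ` \<P> = {vec n (\<lambda>i. ratfun_eval (monomial_curve M i) t) | t.
        \<forall>i<n. ratfun_defined (monomial_curve M i) t}"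
      unfolding \<P>_def by (rule image(1))
    \<comment> \<open>The two representatives differ by the factor 1 / M(t).\<close>
    have N_point: "(*\<^sub>v) N\<^sub>F ` proj_point (vCons 1 x) = proj_point (rnc_vec n r t 1)"
      if x: "x \<in> carrier_vec n" and t: "aeval M t \<noteq> 0"
        and y: "?\<chi> x = vec n (\<lambda>i. ratfun_eval (monomial_curve M i) t)" for x t
    proof -
      have y_k: "?\<chi> x $ k = (if k < r then t ^ k / aeval M t else 0)" if "k < n" for k
        unfolding y using that by (simp add: ratfun_eval_monomial_curve[OF t] r_deg)
      \<comment> \<open>As M is monic, removing its lower terms from M(t) leaves t^r; divided by
        M(t), this is coordinate r.\<close>
      have "aeval M t = t ^ r + (\<Sum>k<r. to_ac (poly.coeff M k) * t ^ k)"
      proof -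
        have "aeval M t = (\<Sum>i<Suc r. to_ac (poly.coeff M i) * t ^ i)"
          by (rule aeval_small_degree) (simp add: r_deg)
        moreover have "poly.coeff M r = 1" using M by (simp add: is_min_poly_def r_deg)
        ultimately show ?thesis by simp
      qed
      moreover have "(\<Sum>k<r. to_ac (poly.coeff M k) * ?\<chi> x $ k) =
          (\<Sum>k<r. to_ac (poly.coeff M k) * t ^ k) / aeval M t"
        unfolding sum_divide_distrib
        by (rule sum.cong) (use y_k rn in auto)
      ultimately have r_coord: "1 - (\<Sum>k<r. to_ac (poly.coeff M k) * ?\<chi> x $ k) = t ^ r / aeval M t"
        using t by (simp add: field_simps)
      have "N\<^sub>F *\<^sub>v vCons 1 x = vec (Suc n) (\<lambda>i. if i < r then ?\<chi> x $ i else
          if i = r then 1 - (\<Sum>k<r. to_ac (poly.coeff M k) * ?\<chi> x $ k) else ?\<chi> x $ (i - 1))"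
        unfolding N\<^sub>F_def N_def map_mat_rnc_mat[OF AB(1) b' rn] A\<^sub>F_def[symmetric] b\<^sub>F_def[symmetric]
        by (subst rnc_mat_mult_vec[OF carrier(1,3) x rn, of "?\<chi> x"]) (simp_all only: one_smult_vec o_apply)
      \<comment> \<open>For i > r the coordinate is y_(i-1) with i - 1 at least r, hence
        zero.\<close>
      also have "\<dots> = (1 / aeval M t) \<cdot>\<^sub>v rnc_vec n r t 1"
        unfolding r_coord using rn by (intro eq_vecI) (auto simp: y_k simp del: index_add_vec)
      finally have N_x: "N\<^sub>F *\<^sub>v vCons 1 x = (1 / aeval M t) \<cdot>\<^sub>v rnc_vec n r t 1" .
      have x': "vCons 1 x \<in> carrier_vec (Suc n)" using x by simp
      show ?thesis
        unfolding proj_image_mat[OF N_F(1) x'] proj_point_iff[OF mult_mat_vec_carrier[OF N_F(1) x']]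
        using t N_x by (intro exI[of _ "1 / aeval M t"]) simp
    qed
    \<comment> \<open>The excluded parameters are exactly the roots of M, for the hypercircle as for
      the monomial curve, because the affine map matches the two parametrized sets.\<close>
    have param: "(\<lambda>x. (*\<^sub>v) N\<^sub>F ` proj_point (vCons 1 x)) ` \<P> =
        {proj_point (rnc_vec n r t 1) | t. t \<notin> {t. aeval M t = 0}}"
    proof (intro equalityI subsetI)
      fix P assume "P \<in> (\<lambda>x. (*\<^sub>v) N\<^sub>F ` proj_point (vCons 1 x)) ` \<P>"
      then obtain x where x: "x \<in> \<P>" "P = (*\<^sub>v) N\<^sub>F ` proj_point (vCons 1 x)" by blast
      have "?\<chi> x \<in> ?\<chi> ` \<P>" using x by blast
      then obtain t where t: "?\<chi> x = vec n (\<lambda>i. ratfun_eval (monomial_curve M i) t)"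
        "\<forall>i<n. ratfun_defined (monomial_curve M i) t"
        unfolding \<chi>_\<P> by blast
      then have "aeval M t \<noteq> 0"
        using ratfun_defined_monomial_curve r_pos rn r_deg by blast
      then show "P \<in> {proj_point (rnc_vec n r t 1) | t. t \<notin> {t. aeval M t = 0}}"
        using N_point[OF _ _ t(1)] x \<P> by blast
    next
      fix P assume "P \<in> {proj_point (rnc_vec n r t 1) | t. t \<notin> {t. aeval M t = 0}}"
      then obtain t where t: "aeval M t \<noteq> 0" "P = proj_point (rnc_vec n r t 1)" by blast
      then have "\<forall>i<n. ratfun_defined (monomial_curve M i) t"
        using ratfun_defined_monomial_curve r_pos rn r_deg by blast
      then have "vec n (\<lambda>i. ratfun_eval (monomial_curve M i) t) \<in> ?\<chi> ` \<P>"
        unfolding \<chi>_\<P> by blast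
      then obtain x where x: "x \<in> \<P>" "?\<chi> x = vec n (\<lambda>i. ratfun_eval (monomial_curve M i) t)"
        by force
      then have "P = (*\<^sub>v) N\<^sub>F ` proj_point (vCons 1 x)"
        using N_point[OF _ t(1) x(2)] t(2) \<P> by auto
      then show "P \<in> (\<lambda>x. (*\<^sub>v) N\<^sub>F ` proj_point (vCons 1 x)) ` \<P>" using x(1) by blast
    qed
    have emb: "(\<lambda>x. proj_point (vCons 1 x)) ` \<P> \<subseteq> proj_space n"
    proof
      fix P assume "P \<in> (\<lambda>x. proj_point (vCons 1 x)) ` \<P>"
      then obtain x where "x \<in> carrier_vec n" "P = proj_point (vCons 1 x)" using \<P> by blast
      then show "P \<in> proj_space n"
        by (auto intro!: proj_point_in_proj_space simp: zero_vec_Suc)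
    qed
    \<comment> \<open>The affine closure inside \<open>rational_curve\<close> is absorbed, so that
      only one closure remains, in projective space.\<close>
    have "proj_closure n U = proj_closure n \<P>"
      unfolding U_eq rational_curve_def \<P>_def[symmetric]
      by (rule proj_closure_zariski_closure[OF \<P>])
    then have "(`) ((*\<^sub>v) N\<^sub>F) ` proj_closure n U =
        proj_zariski_closed n hull ((\<lambda>x. (*\<^sub>v) N\<^sub>F ` proj_point (vCons 1 x)) ` \<P>)"
      by (simp add: proj_closure_def proj_image_hull[OF N_F emb] image_image)
    also have "\<dots> = rational_normal_curve n r"
      unfolding param
    proof (rule proj_hull_rational_normal_curve[OF _ rn])
      show "finite {t. aeval M t = 0}"
        using is_min_poly_nonzero[OF M] by (intro poly_roots_finite) simp
    qed
    finally show "(`) ((*\<^sub>v) N\<^sub>F) ` proj_closure n U = rational_normal_curve n r" .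
  qed
  ultimately show ?thesis unfolding curve_eq ..
qed

end
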